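(* Let $\omega\in C^1\Lambda^k(\mathcal{P})$. There is a constant $C$, depending on $\omega$ but not on $h$ or on the simplices, such that for every $h$, every $n$-simplex $\sigma$ of $K_h$ and every $k$-dimensional face $\tau$ of $\sigma$, $$\big|\langle \star_h R_h\omega,\ast\tau\rangle-\langle R_h\star\omega,\ast\tau\rangle\big|\le C\,\frac{h^{n+1}}{\gamma_\tau^{\,k}}.$$
   Context: Let $\mathcal{P}\subset\mathbb{R}^n$ be an $n$-dimensional polytope and $\{K_h\}_{h>0}$ a family of simplicial complexes triangulating $\mathcal{P}$ (the union of the $n$-simplices is $\mathcal{P}$), where $h$ is the length of the longest edge of $K_h$. Each $K_h$ is well-centered: the circumcenter $c(s)$ of every simplex $s$ of every dimension lies in the relative interior of $s$. $\gamma_s$ is the radius of the largest $\dim(s)$-dimensional ball contained in $s$. All simplices are oriented, the $n$-simplices with the standard orientation of $\mathbb{R}^n$. $|s|$ is the $k$-volume of a $k$-simplex $s$ (vertices have volume $1$). For a $k$-simplex $\tau$, the circumcentric dual $\ast\tau$ is the $(n-k)$-dimensional cell formed by the union of the simplices $[c(\tau),c(\tau_{k+1}),\dots,c(\tau_n)]$ over all chains $\tau\prec\tau_{k+1}\prec\dots\prec\tau_n$ of simplices of $K_h$ with $\dim\tau_j=j$. It lies in the affine plane through $c(\tau)$ orthogonal to $\tau$, and is oriented so that an oriented basis of $\tau$ followed by an oriented basis of $\ast\tau$ is positively oriented in $\mathbb{R}^n$. $|\ast\tau|$ is its $(n-k)$-volume, with $|\ast\sigma|=1$ for $n$-simplices.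 $C^1\Lambda^k(\mathcal{P})$ is the set of restrictions to $\mathcal{P}$ of $C^1$ differential $k$-forms defined on an open set containing $\mathcal{P}$. $\star$ is the Euclidean Hodge star. The de Rham map is $\langle R_h\omega,s\rangle=\int_s\omega$ for $s$ an oriented $k$-simplex or dual $k$-cell. The discrete Hodge star of a $k$-cochain $\alpha$ (a real function on oriented $k$-simplices, changing sign with orientation) is the cochain on dual cells given by $\langle\star_h\alpha,\ast\tau\rangle=\frac{|\ast\tau|}{|\tau|}\langle\alpha,\tau\rangle$. *)

theory Defs
  imports "HOL-Analysis.Analysis"
begin

definition ndet :: "nat \<Rightarrow> (nat \<Rightarrow> nat \<Rightarrow> real) \<Rightarrow> real" where
  "ndet m M = (\<Sum>p | p permutes {..<m}. of_int (sign p) * (\<Prod>i<m. M i (p i)))"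

text \<open>A fixed enumeration of the coordinate axes; it fixes the standard orientation of R^n
  as the ordered basis (axis (coord_enum 0) 1, ..., axis (coord_enum (n-1)) 1).\<close>
definition coord_enum :: "nat \<Rightarrow> 'n::finite" where
  "coord_enum = (SOME f. bij_betw f {..<CARD('n)} (UNIV::'n set))"

definition orient_det :: "(nat \<Rightarrow> real^'n) \<Rightarrow> real" where
  "orient_det w = ndet CARD('n) (\<lambda>i j. w i $ coord_enum j)"

definition alt_form :: "nat \<Rightarrow> ((nat \<Rightarrow> real^'n) \<Rightarrow> real) \<Rightarrow> bool" where
  "alt_form k a \<longleftrightarrow>
     (\<forall>v v'. (\<forall>j<k. v j = v' j) \<longrightarrow> a v = a v') \<and>
     (\<forall>j<k. \<forall>v. linear (\<lambda>u. a (v(j := u)))) \<and>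
     (\<forall>v i j. i < k \<and> j < k \<and> i \<noteq> j \<and> v i = v j \<longrightarrow> a v = 0)"

definition hodge :: "nat \<Rightarrow> ((nat \<Rightarrow> real^'n) \<Rightarrow> real) \<Rightarrow> (nat \<Rightarrow> real^'n) \<Rightarrow> real" where
  "hodge k a w =
     (\<Sum>i \<in> PiE {..<k} (\<lambda>_. (UNIV::'n set)).
        a (\<lambda>j. axis (i j) 1) *
        orient_det (\<lambda>l. if l < k then axis (i l) (1::real) else w (l - k))) / fact k"

definition C1_form :: "(real^'n) set \<Rightarrow> nat \<Rightarrow> (real^'n \<Rightarrow> (nat \<Rightarrow> real^'n) \<Rightarrow> real) \<Rightarrow> bool" where
  "C1_form P k \<omega> \<longleftrightarrow>
     (\<exists>U. open U \<and> P \<subseteq> U \<and> (\<forall>x\<in>U. alt_form k (\<omega> x)) \<and>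
        (\<forall>v. \<exists>D :: (real^'n) \<Rightarrow> ((real^'n) \<Rightarrow>\<^sub>L real).
             (\<forall>x\<in>U. ((\<lambda>y. \<omega> y v) has_derivative blinfun_apply (D x)) (at x)) \<and>
             continuous_on U D))"

definition std_simplex :: "nat \<Rightarrow> (nat \<Rightarrow> real) set" where
  "std_simplex k = {t \<in> PiE {..<k} (\<lambda>_. UNIV). (\<forall>j<k. 0 \<le> t j) \<and> (\<Sum>j<k. t j) \<le> 1}"

definition simplex_map :: "nat \<Rightarrow> (nat \<Rightarrow> real^'n) \<Rightarrow> (nat \<Rightarrow> real) \<Rightarrow> real^'n" where
  "simplex_map k vs t = vs 0 + (\<Sum>j<k. t j *\<^sub>R (vs (Suc j) - vs 0))"

text \<open>Integral of a k-form over the oriented k-simplex [vs 0, ..., vs k] (pullback by the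
  affine parametrisation of the standard simplex).\<close>
definition integ :: "nat \<Rightarrow> (real^'n \<Rightarrow> (nat \<Rightarrow> real^'n) \<Rightarrow> real) \<Rightarrow> (nat \<Rightarrow> real^'n) \<Rightarrow> real" where
  "integ k \<omega> vs =
     integral\<^sup>L (Pi\<^sub>M {..<k} (\<lambda>_. lborel))
       (\<lambda>t. indicator (std_simplex k) t *
             \<omega> (simplex_map k vs t) (\<lambda>j. vs (Suc j) - vs 0))"

text \<open>k-volume of the simplex [vs 0, ..., vs k] (Gram determinant formula; 1 for k = 0).\<close>
definition kvol :: "nat \<Rightarrow> (nat \<Rightarrow> real^'n) \<Rightarrow> real" where
  "kvol k vs = sqrt (ndet k (\<lambda>i j. (vs (Suc i) - vs 0) \<bullet> (vs (Suc j) - vs 0))) / fact k"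

text \<open>Abstract simplices are represented by their (finite, affinely independent) vertex sets.\<close>
definition simplicial_complex :: "(real^'n) set set \<Rightarrow> bool" where
  "simplicial_complex K \<longleftrightarrow>
     finite K \<and>
     (\<forall>s\<in>K. finite s \<and> s \<noteq> {} \<and> \<not> affine_dependent s) \<and>
     (\<forall>s\<in>K. \<forall>t. t \<subseteq> s \<and> t \<noteq> {} \<longrightarrow> t \<in> K) \<and>
     (\<forall>s\<in>K. \<forall>t\<in>K. convex hull s \<inter> convex hull t = convex hull (s \<inter> t))"

definition triangulates :: "(real^'n) set set \<Rightarrow> (real^'n) set \<Rightarrow> bool" where
  "triangulates K P \<longleftrightarrow> simplicial_complex K \<and>
     \<Union>{convex hull s | s. s \<in> K \<and> card s = CARD('n) + 1} = P"

definition circumcenter :: "(real^'n) set \<Rightarrow> real^'n" where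
  "circumcenter s = (THE c. c \<in> affine hull s \<and> (\<forall>v\<in>s. \<forall>w\<in>s. dist c v = dist c w))"

definition well_centered :: "(real^'n) set set \<Rightarrow> bool" where
  "well_centered K \<longleftrightarrow> (\<forall>s\<in>K. circumcenter s \<in> rel_interior (convex hull s))"

definition max_edge :: "(real^'n) set set \<Rightarrow> real" where
  "max_edge K = Max {dist a b | a b. {a, b} \<in> K \<and> a \<noteq> b}"

definition inradius :: "(real^'n) set \<Rightarrow> real" where
  "inradius s = Sup {r. 0 \<le> r \<and> (\<exists>c \<in> affine hull s. cball c r \<inter> affine hull s \<subseteq> convex hull s)}"

definition dual_chains :: "(real^'n) set set \<Rightarrow> nat \<Rightarrow> (real^'n) set \<Rightarrow> (nat \<Rightarrow> (real^'n) set) set" where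
  "dual_chains K k \<tau> =
     {ch \<in> PiE {..CARD('n) - k} (\<lambda>_. K). ch 0 = \<tau> \<and>
        (\<forall>j < CARD('n) - k. ch j \<subset> ch (Suc j)) \<and>
        (\<forall>j \<le> CARD('n) - k. card (ch j) = k + j + 1)}"

definition dual_vol :: "(real^'n) set set \<Rightarrow> nat \<Rightarrow> (real^'n) set \<Rightarrow> real" where
  "dual_vol K k \<tau> =
     (\<Sum>ch \<in> dual_chains K k \<tau>. kvol (CARD('n) - k) (\<lambda>j. circumcenter (ch j)))"

text \<open>de Rham map of an (n-k)-form eta on the dual cell of the oriented k-simplex
  [vs 0, ..., vs k] (with tau its vertex set); each piece is oriented so that the basis of
  tau followed by the basis of the piece is positively oriented.\<close>
definition dual_integ :: "(real^'n) set set \<Rightarrow> nat \<Rightarrow> (real^'n \<Rightarrow> (nat \<Rightarrow> real^'n) \<Rightarrow> real)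
     \<Rightarrow> (nat \<Rightarrow> real^'n) \<Rightarrow> real" where
  "dual_integ K k \<eta> vs =
     (\<Sum>ch \<in> dual_chains K k (vs ` {..k}).
        sgn (orient_det (\<lambda>l. if l < k then vs (Suc l) - vs 0
                              else circumcenter (ch (Suc (l - k))) - circumcenter (ch 0))) *
        integ (CARD('n) - k) \<eta> (\<lambda>j. circumcenter (ch j)))"

definition discrete_hodge_deRham :: "(real^'n) set set \<Rightarrow> nat \<Rightarrow> (real^'n \<Rightarrow> (nat \<Rightarrow> real^'n) \<Rightarrow> real)
     \<Rightarrow> (nat \<Rightarrow> real^'n) \<Rightarrow> real" where
  "discrete_hodge_deRham K k \<omega> vs =
     dual_vol K k (vs ` {..k}) / kvol k vs * integ k \<omega> vs"

end

theory Submission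
  imports Defs
begin

text \<open>
  For a chain \<open>\<tau> \<prec> \<tau>\<^sub>k\<^sub>+\<^sub>1 \<prec> \<dots> \<prec> \<tau>\<^sub>n\<close> the differences of circumcenters span directions
  orthogonal to \<open>\<tau>\<close>. For a constant form the discrete and the smooth Hodge star then agree exactly
  on the corresponding piece of \<open>\<ast>\<tau>\<close>: multiplied by the orientation determinant, both reduce to
  products of Gram determinants. For a form with Lipschitz coefficients the error on a piece is
  therefore the difference of two averages of one Lipschitz function over a set of diameter at most
  \<open>h\<close>, that is, \<open>O(h)\<close> times the volume of the piece. Well-centeredness makes the pieces of
  \<open>\<ast>\<tau>\<close> non-overlapping, so \<open>|\<ast>\<tau>| = O(h\<^sup>n\<^sup>-\<^sup>k)\<close> however many simplices contain \<open>\<tau>\<close>. The sum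
  of the errors is \<open>O(h\<^sup>n\<^sup>-\<^sup>k\<^sup>+\<^sup>1)\<close>, and the inradius of \<open>\<tau>\<close> is at most \<open>h\<close>.
\<close>

section \<open>Determinants and the Hodge star\<close>

text \<open>No shape regularity is assumed: simplices may be arbitrarily flat. This does no harm
  because the factor \<open>1 / kvol k vs\<close> cancels: the integral over \<open>\<tau>\<close>
  is an average times a determinant factor, and the averages are controlled by the diameter alone.
  For the same reason every estimate on a dual piece must be linear in its volume
  \<open>kvol\<close>, never in a product of its edge lengths; only then can the errors be summed
  over a number of pieces that is out of control. The algebra rests on one identity: the product of
  two determinants is the determinant of the mutual inner products of their rows. Since
  \<open>\<tau>\<close> is orthogonal to its dual pieces, that matrix is block triangular and splits
  into a factor for \<open>\<tau>\<close> and a Gram factor for the piece. The final constant is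
  \<open>\<Lambda> * V\<close>. Here \<open>\<Lambda>\<close> is twice the sum of the Lipschitz
  constants of the form on tuples of axes, and \<open>V\<close> is the volume ratio of the unit ball
  and the standard simplex, as it arises from packing disjoint simplices into a ball.\<close>

lemma ndet_cong:
  assumes "\<And>i j. i < m \<Longrightarrow> j < m \<Longrightarrow> M i j = N i j"
  shows "ndet m M = ndet m N"
  unfolding ndet_def
proof (intro sum.cong refl arg_cong2[where f = "(*)"] prod.cong)
  fix p i assume "p \<in> {p. p permutes {..<m}}" "i \<in> {..<m}"
  then show "M i (p i) = N i (p i)"
    using assms permutes_in_image[of p "{..<m}" i] by auto
qed

text \<open>Conjugation by \<open>f\<close> carries permutations of \<open>A\<close> to permutations
  of \<open>B\<close> and keeps their signs. This links determinants numbered by naturals with those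
  indexed by a finite type, and also shifts a block to start at 0.\<close>

lemma sum_permutes_reindex:
  fixes M :: "'b \<Rightarrow> 'b \<Rightarrow> real"
  assumes f: "bij_betw f A B" and "finite A"
  shows "(\<Sum>p | p permutes A. of_int (sign p) * (\<Prod>i\<in>A. M (f i) (f (p i)))) =
         (\<Sum>p | p permutes B. of_int (sign p) * (\<Prod>i\<in>B. M i (p i)))"
proof (rule sum.reindex_bij_witness[where j = "map_permutation A f" and i = "map_permutation B (inv_into A f)"])
  fix p assume "p \<in> {p. p permutes A}"
  then have p: "p permutes A" by simp
  show "map_permutation B (inv_into A f) (map_permutation A f p) = p"
    using f p by (intro map_permutation_compose_inv) (auto simp: bij_betw_def)
  show "map_permutation A f p \<in> {p. p permutes B}"
    using map_permutation_permutes[OF f p] by simp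
  have "(\<Prod>i\<in>B. M i (map_permutation A f p i)) = (\<Prod>i\<in>A. M (f i) (map_permutation A f p (f i)))"
    by (rule prod.reindex_bij_betw[OF f, symmetric])
  also have "\<dots> = (\<Prod>i\<in>A. M (f i) (f (p i)))"
    using f by (intro prod.cong refl) (auto simp: map_permutation_def restrict_id_def bij_betw_def)
  finally show "of_int (sign (map_permutation A f p)) * (\<Prod>i\<in>B. M i (map_permutation A f p i)) =
      of_int (sign p) * (\<Prod>i\<in>A. M (f i) (f (p i)))"
    using f p \<open>finite A\<close> by (simp add: sign_map_permutation bij_betw_def)
next
  have f': "bij_betw (inv_into A f) B A" by (rule bij_betw_inv_into[OF f])
  fix q assume "q \<in> {q. q permutes B}"
  then have q: "q permutes B" by simp
  show "map_permutation A f (map_permutation B (inv_into A f) q) = q"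
    using f' q f by (intro map_permutation_compose_inv) (auto simp: bij_betw_inv_into_right)
  show "map_permutation B (inv_into A f) q \<in> {p. p permutes A}"
    using map_permutation_permutes[OF f' q] by simp
qed

lemma ndet_eq_det:
  fixes f :: "nat \<Rightarrow> 'm::finite"
  assumes "bij_betw f {..<m} UNIV"
  shows "ndet m (\<lambda>i j. M (f i) (f j)) = det (\<chi> i j. M i j)"
  using sum_permutes_reindex[OF assms, of M] by (simp add: ndet_def det_def)

text \<open>A permutation contributes only if it maps \<open>B\<close> into \<open>B\<close>; by
  finiteness it then preserves both \<open>A\<close> and \<open>B\<close> and is the composition of
  its restrictions, whose signs and products multiply.\<close>

lemma sum_permutes_block_triangular:
  fixes M :: "'a \<Rightarrow> 'a \<Rightarrow> real"
  assumes fin: "finite A" "finite B" and disj: "A \<inter> B = {}"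
    and zero: "\<And>i j. i \<in> B \<Longrightarrow> j \<in> A \<Longrightarrow> M i j = 0"
  shows "(\<Sum>r | r permutes A \<union> B. of_int (sign r) * (\<Prod>i\<in>A \<union> B. M i (r i))) =
         (\<Sum>p | p permutes A. of_int (sign p) * (\<Prod>i\<in>A. M i (p i))) *
         (\<Sum>q | q permutes B. of_int (sign q) * (\<Prod>i\<in>B. M i (q i)))"
proof -
  let ?R = "{r. r permutes A \<union> B}"
  have "(\<Sum>r \<in> ?R. of_int (sign r) * (\<Prod>i\<in>A \<union> B. M i (r i))) =
      (\<Sum>r \<in> {r \<in> ?R. r ` B \<subseteq> B}. of_int (sign r) * (\<Prod>i\<in>A \<union> B. M i (r i)))"
  proof (rule sum.mono_neutral_right)
    show "finite ?R" using fin by (simp add: finite_permutations)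
    show "\<forall>r\<in>?R - {r \<in> ?R. r ` B \<subseteq> B}. of_int (sign r) * (\<Prod>i\<in>A \<union> B. M i (r i)) = 0"
    proof
      fix r assume "r \<in> ?R - {r \<in> ?R. r ` B \<subseteq> B}"
      then obtain i where i: "i \<in> B" "r i \<notin> B" and "r permutes A \<union> B" by blast
      then have "r i \<in> A" using permutes_in_image[of r "A \<union> B" i] by auto
      then have "M i (r i) = 0" using zero i by blast
      then have "(\<Prod>i\<in>A \<union> B. M i (r i)) = 0"
        using i(1) fin by (intro prod_zero) auto
      then show "of_int (sign r) * (\<Prod>i\<in>A \<union> B. M i (r i)) = 0" by simp
    qed
  qed auto
  also have "\<dots> = (\<Sum>(p, q) \<in> {p. p permutes A} \<times> {q. q permutes B}.
      (of_int (sign p) * (\<Prod>i\<in>A. M i (p i))) * (of_int (sign q) * (\<Prod>i\<in>B. M i (q i))))"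
  proof (rule sum.reindex_bij_witness[where j = "\<lambda>r. (restrict_id r A, restrict_id r B)"
        and i = "\<lambda>(p, q). p \<circ> q"])
    fix r assume "r \<in> {r \<in> ?R. r ` B \<subseteq> B}"
    then have r: "r permutes A \<union> B" "r ` B \<subseteq> B" by auto
    have inj: "inj r" using permutes_inj[OF r(1)] .
    have rB: "r ` B = B" using endo_inj_surj[OF fin(2) r(2)] inj inj_on_subset by blast
    have rA: "r ` A = A"
    proof -
      have "r ` A = r ` (A \<union> B) - r ` B" using inj disj by (auto dest: injD)
      then show ?thesis using permutes_image[OF r(1)] rB disj by auto
    qed
    have pA: "restrict_id r A permutes A"
      using inj_on_subset[OF inj] rA by (intro permutes_restrict_id) (simp add: bij_betw_def)
    have pB: "restrict_id r B permutes B"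
      using inj_on_subset[OF inj] rB by (intro permutes_restrict_id) (simp add: bij_betw_def)
    show comp: "(case (restrict_id r A, restrict_id r B) of (p, q) \<Rightarrow> p \<circ> q) = r"
      using disj rB permutes_not_in[OF r(1)] by (auto simp: fun_eq_iff restrict_id_def)
    show "(restrict_id r A, restrict_id r B) \<in> {p. p permutes A} \<times> {q. q permutes B}"
      using pA pB by simp
    have "sign r = sign (restrict_id r A) * sign (restrict_id r B)"
      using comp sign_compose[of "restrict_id r A" "restrict_id r B"] pA pB fin
      by (auto intro: permutes_imp_permutation)
    moreover have "(\<Prod>i\<in>A \<union> B. M i (r i)) = (\<Prod>i\<in>A. M i (restrict_id r A i)) * (\<Prod>i\<in>B. M i (restrict_id r B i))"
      using fin disj by (simp add: prod.union_disjoint restrict_id_def)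
    ultimately show "(case (restrict_id r A, restrict_id r B) of (p, q) \<Rightarrow>
        (of_int (sign p) * (\<Prod>i\<in>A. M i (p i))) * (of_int (sign q) * (\<Prod>i\<in>B. M i (q i)))) =
        of_int (sign r) * (\<Prod>i\<in>A \<union> B. M i (r i))"
      by simp
  next
    fix x assume "x \<in> {p. p permutes A} \<times> {q. q permutes B}"
    then obtain p q where x: "x = (p, q)" and pq: "p permutes A" "q permutes B" by auto
    have pB: "p i = i" if "i \<in> B" for i using permutes_not_in[OF pq(1)] that disj by blast
    have qA: "q i = i" if "i \<in> A" for i
      using permutes_not_in[OF pq(2)] that disj by blast
    have qB: "q i \<in> B" if "i \<in> B" for i using permutes_in_image[OF pq(2)] that by blast
    show "(restrict_id (case x of (p, q) \<Rightarrow> p \<circ> q) A, restrict_id (case x of (p, q) \<Rightarrow> p \<circ> q) B) = x"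
      using pB qA qB disj permutes_not_in[OF pq(1)] permutes_not_in[OF pq(2)] by (auto simp: x fun_eq_iff restrict_id_def)
    have "p \<circ> q permutes A \<union> B"
      using pq by (intro permutes_compose) (auto elim: permutes_subset)
    moreover have "(p \<circ> q) ` B \<subseteq> B" using pB qB by auto
    ultimately show "(case x of (p, q) \<Rightarrow> p \<circ> q) \<in> {r \<in> ?R. r ` B \<subseteq> B}" by (simp add: x)
  qed
  also have "\<dots> = (\<Sum>p | p permutes A. of_int (sign p) * (\<Prod>i\<in>A. M i (p i))) *
         (\<Sum>q | q permutes B. of_int (sign q) * (\<Prod>i\<in>B. M i (q i)))"
    by (simp add: sum_product sum.cartesian_product)
  finally show ?thesis .
qed

lemma ndet_block_upper_triangular:
  assumes "k \<le> m" and zero: "\<And>i j. k \<le> i \<Longrightarrow> i < m \<Longrightarrow> j < k \<Longrightarrow> M i j = 0"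
  shows "ndet m M = ndet k M * ndet (m - k) (\<lambda>i j. M (k + i) (k + j))"
proof -
  have bij: "bij_betw ((+) k) {..<m - k} {k..<m}"
    using \<open>k \<le> m\<close> by (intro bij_betwI[where g = "\<lambda>i. i - k"]) auto
  have "ndet (m - k) (\<lambda>i j. M (k + i) (k + j)) =
      (\<Sum>q | q permutes {k..<m}. of_int (sign q) * (\<Prod>i\<in>{k..<m}. M i (q i)))"
    using sum_permutes_reindex[OF bij, of M] by (simp add: ndet_def)
  moreover have "{..<m} = {..<k} \<union> {k..<m}" using \<open>k \<le> m\<close> by auto
  ultimately show ?thesis
    unfolding ndet_def using zero
    by (simp only:) (rule sum_permutes_block_triangular; auto)
qed

section \<open>Orientation determinants and Gram determinants\<close>

lemma bij_betw_coord_enum: "bij_betw (coord_enum :: nat \<Rightarrow> 'n::finite) {..<CARD('n)} UNIV"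
proof -
  have "\<exists>f. bij_betw f {..<CARD('n)} (UNIV::'n set)"
    by (metis ex_bij_betw_nat_finite finite_code atLeast0LessThan)
  then show ?thesis
    unfolding coord_enum_def by (rule someI_ex)
qed

text \<open>Rows and columns are renumbered by the same bijection, so no sign appears.\<close>

lemma orient_det_eq_det:
  fixes w :: "nat \<Rightarrow> real^'n"
  shows "orient_det w = det (\<chi> c d. w (inv_into {..<CARD('n)} coord_enum c) $ d)"
proof -
  let ?g = "inv_into {..<CARD('n)} (coord_enum :: nat \<Rightarrow> 'n)"
  have "orient_det w = ndet CARD('n) (\<lambda>i j. w (?g (coord_enum i)) $ coord_enum j)"
    unfolding orient_det_def
    by (rule ndet_cong) (simp add: bij_betw_inv_into_left[OF bij_betw_coord_enum])
  also have "\<dots> = det (\<chi> c d. w (?g c) $ d)"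
    by (rule ndet_eq_det[OF bij_betw_coord_enum])
  finally show ?thesis .
qed

text \<open>Multiplicativity for a matrix times a transposed one, whose entries are inner products
  of rows. The chosen enumeration of the axes disappears from the right-hand side.\<close>

lemma orient_det_mult:
  fixes v w :: "nat \<Rightarrow> real^'n"
  shows "orient_det v * orient_det w = ndet CARD('n) (\<lambda>i j. v i \<bullet> w j)"
proof -
  let ?g = "inv_into {..<CARD('n)} (coord_enum :: nat \<Rightarrow> 'n)"
  let ?V = "\<chi> c d. v (?g c) $ d" and ?W = "\<chi> c d. w (?g c) $ d"
  have "ndet CARD('n) (\<lambda>i j. v i \<bullet> w j) =
      ndet CARD('n) (\<lambda>i j. v (?g (coord_enum i)) \<bullet> w (?g (coord_enum j)))"
    by (rule ndet_cong) (simp add: bij_betw_inv_into_left[OF bij_betw_coord_enum])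
  also have "\<dots> = det (\<chi> c d. v (?g c) \<bullet> w (?g d))"
    by (rule ndet_eq_det[OF bij_betw_coord_enum])
  also have "(\<chi> c d. v (?g c) \<bullet> w (?g d)) = ?V ** transpose ?W"
    by (simp add: matrix_matrix_mult_def transpose_def inner_vec_def)
  finally show ?thesis
    by (simp add: orient_det_eq_det det_mul det_transpose)
qed

text \<open>Only the block of the \<open>p i \<bullet> e j\<close> has to vanish; the opposite block
  \<open>b i \<bullet> p j\<close> is arbitrary. Hence \<open>b\<close> is free and can be a tuple
  of axes, as in \<open>hodge\<close>, as well as the edges of \<open>\<tau>\<close> or an
  orthonormal frame.\<close>

lemma orient_det_mult_orthogonal:
  fixes b e p :: "nat \<Rightarrow> real^'n"
  assumes "k \<le> CARD('n)" and orth: "\<And>i j. i < CARD('n) - k \<Longrightarrow> j < k \<Longrightarrow> p i \<bullet> e j = 0"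
  shows "orient_det (\<lambda>l. if l < k then b l else p (l - k)) *
         orient_det (\<lambda>l. if l < k then e l else p (l - k)) =
         ndet k (\<lambda>i j. b i \<bullet> e j) * ndet (CARD('n) - k) (\<lambda>i j. p i \<bullet> p j)"
proof -
  let ?b = "\<lambda>l. if l < k then b l else p (l - k)"
  let ?e = "\<lambda>l. if l < k then e l else p (l - k)"
  have "orient_det ?b * orient_det ?e = ndet CARD('n) (\<lambda>i j. ?b i \<bullet> ?e j)"
    by (rule orient_det_mult)
  also have "\<dots> = ndet k (\<lambda>i j. ?b i \<bullet> ?e j) *
      ndet (CARD('n) - k) (\<lambda>i j. ?b (k + i) \<bullet> ?e (k + j))"
    using assms by (intro ndet_block_upper_triangular) auto
  also have "ndet k (\<lambda>i j. ?b i \<bullet> ?e j) = ndet k (\<lambda>i j. b i \<bullet> e j)"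
    by (rule ndet_cong) auto
  finally show ?thesis by simp
qed

section \<open>Alternating forms and the smooth Hodge star\<close>

lemma sum_PiE_lessThan_Suc:
  fixes f :: "(nat \<Rightarrow> 'a) \<Rightarrow> 'b::comm_monoid_add"
  shows "(\<Sum>i \<in> PiE {..<Suc m} (\<lambda>_. A). f i) = (\<Sum>i \<in> PiE {..<m} (\<lambda>_. A). \<Sum>c\<in>A. f (i(m := c)))"
proof -
  have inj: "inj_on (\<lambda>(y, g). g(m := y)) (A \<times> PiE {..<m} (\<lambda>_. A))"
    by (rule inj_combinator) simp
  have "(\<Sum>i \<in> PiE {..<Suc m} (\<lambda>_. A). f i) = (\<Sum>(y, g) \<in> A \<times> PiE {..<m} (\<lambda>_. A). f (g(m := y)))"
    unfolding lessThan_Suc PiE_insert_eq sum.reindex[OF inj]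
    by (simp add: case_prod_unfold)
  also have "\<dots> = (\<Sum>i \<in> PiE {..<m} (\<lambda>_. A). \<Sum>c\<in>A. f (i(m := c)))"
    by (simp add: sum.cartesian_product[symmetric] sum.swap[of _ A])
  finally show ?thesis .
qed

lemma alt_form_cong: "alt_form k a \<Longrightarrow> (\<And>j. j < k \<Longrightarrow> v j = v' j) \<Longrightarrow> a v = a v'"
  unfolding alt_form_def by blast

text \<open>Multilinearity, one argument at a time: the statement for general \<open>m\<close>, with
  axes in the first \<open>m\<close> slots, is the induction invariant, and \<open>m = k\<close> is
  the case of interest.\<close>

lemma alt_form_expand:
  fixes v :: "nat \<Rightarrow> real^'n"
  assumes a: "alt_form k a" and "m \<le> k"
  shows "a v = (\<Sum>i \<in> PiE {..<m} (\<lambda>_. UNIV::'n set). (\<Prod>l<m. v l $ i l) *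
                  a (\<lambda>j. if j < m then axis (i j) 1 else v j))"
  using \<open>m \<le> k\<close>
proof (induction m)
  case 0
  then show ?case by simp
next
  case (Suc m)
  have step: "a (\<lambda>j. if j < m then axis (i j) 1 else v j) =
      (\<Sum>c\<in>UNIV. v m $ c * a (\<lambda>j. if j < Suc m then axis ((i(m := c)) j) 1 else v j))" for i :: "nat \<Rightarrow> 'n"
  proof -
    define w where "w = (\<lambda>j. if j < m then axis (i j) 1 else v j)"
    have lin: "linear (\<lambda>u. a (w(m := u)))"
      using a Suc.prems unfolding alt_form_def by auto
    have "a w = a (w(m := v m))"
      by (rule arg_cong[where f = a]) (auto simp: w_def)
    also have "v m = (\<Sum>c\<in>UNIV. v m $ c *\<^sub>R axis c 1)"
      using basis_expansion[of "v m"] by (simp add: scalar_mult_eq_scaleR)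
    also have "a (w(m := \<dots>)) = (\<Sum>c\<in>UNIV. v m $ c * a (w(m := axis c 1)))"
      using linear_sum[OF lin, of "\<lambda>c. v m $ c *\<^sub>R axis c 1" UNIV] linear_scale[OF lin] by simp
    also have "\<dots> = (\<Sum>c\<in>UNIV. v m $ c * a (\<lambda>j. if j < Suc m then axis ((i(m := c)) j) 1 else v j))"
      by (intro sum.cong refl arg_cong2[where f = "(*)"] arg_cong[where f = a]) (auto simp: w_def)
    finally show ?thesis by (simp add: w_def)
  qed
  have "a v = (\<Sum>i \<in> PiE {..<m} (\<lambda>_. UNIV::'n set). (\<Prod>l<m. v l $ i l) *
                  a (\<lambda>j. if j < m then axis (i j) 1 else v j))"
    using Suc by simp
  also have "\<dots> = (\<Sum>i \<in> PiE {..<m} (\<lambda>_. UNIV::'n set). \<Sum>c\<in>UNIV. (\<Prod>l<Suc m. v l $ (i(m := c)) l) *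
                  a (\<lambda>j. if j < Suc m then axis ((i(m := c)) j) 1 else v j))"
    by (simp only: step) (simp add: sum_distrib_left mult.assoc)
  finally show ?case
    by (simp only: sum_PiE_lessThan_Suc)
qed

lemma alt_form_swap:
  assumes a: "alt_form k a" and "i < k" "j < k" "i \<noteq> j"
  shows "a (v \<circ> Transposition.transpose i j) = - a v"
proof -
  define f where "f x y = a (v(i := x, j := y))" for x y
  have lin1: "linear (\<lambda>x. f x y)" for y
  proof -
    have "(\<lambda>x. f x y) = (\<lambda>x. a ((v(j := y))(i := x)))"
      using \<open>i \<noteq> j\<close> by (simp add: f_def fun_upd_twist)
    then show ?thesis using a \<open>i < k\<close> unfolding alt_form_def by simp
  qed
  have lin2: "linear (f x)" for x
    using a \<open>j < k\<close> unfolding alt_form_def f_def by simp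
  have zero: "f x x = 0" for x
  proof -
    have "(v(i := x, j := x)) i = (v(i := x, j := x)) j" using \<open>i \<noteq> j\<close> by simp
    then show ?thesis using a assms(2-) unfolding alt_form_def f_def by blast
  qed
  \<comment> \<open>Polarization: the form vanishes on the repeated argument
    \<open>v i + v j\<close>, and so do the two diagonal terms of its expansion.\<close>
  have "0 = f (v i + v j) (v i + v j)" by (simp add: zero)
  also have "\<dots> = f (v i) (v i) + f (v i) (v j) + (f (v j) (v i) + f (v j) (v j))"
    using linear_add[OF lin1] linear_add[OF lin2] by simp
  finally have "f (v j) (v i) = - f (v i) (v j)" by (simp add: zero)
  moreover have "v \<circ> Transposition.transpose i j = v(i := v j, j := v i)"
    using \<open>i \<noteq> j\<close> by (auto simp: fun_eq_iff Transposition.transpose_def)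
  ultimately show ?thesis by (simp add: f_def)
qed

lemma alt_form_permute:
  assumes a: "alt_form k a" and p: "p permutes {..<k}"
  shows "a (v \<circ> p) = of_int (sign p) * a v"
  using p finite_lessThan
proof (induction arbitrary: v rule: permutes_induct)
  case id
  then show ?case by simp
next
  case (swap i j p)
  have "a (v \<circ> (Transposition.transpose i j \<circ> p)) = of_int (sign p) * a (v \<circ> Transposition.transpose i j)"
    using swap.IH[of "v \<circ> Transposition.transpose i j"] by (simp only: o_assoc)
  also have "\<dots> = of_int (- sign p) * a v"
    using alt_form_swap[OF a] swap.hyps by simp
  also have "- sign p = sign (Transposition.transpose i j \<circ> p)"
    using swap.hyps
    by (subst sign_compose) (auto simp: permutation_swap_id sign_swap_id intro: permutation_permutes[THEN iffD2])
  finally show ?case .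
qed

text \<open>In the Leibniz expansion each permutation \<open>p\<close> yields the expansion of
  \<open>a (e \<circ> p)\<close> along the axes; its sign cancels that of \<open>p\<close>, which
  leaves \<open>fact k\<close> equal terms. They match the division by \<open>fact k\<close> in
  \<open>hodge\<close>, where all index tuples are summed and not only the increasing ones.\<close>

lemma sum_alt_form_ndet:
  fixes e :: "nat \<Rightarrow> real^'n"
  assumes a: "alt_form k a"
  shows "(\<Sum>i \<in> PiE {..<k} (\<lambda>_. UNIV::'n set).
            a (\<lambda>j. axis (i j) 1) * ndet k (\<lambda>l j. axis (i l) 1 \<bullet> e j)) = fact k * a e"
proof -
  let ?I = "PiE {..<k} (\<lambda>_. UNIV::'n set)"
  have "(\<Sum>i \<in> ?I. a (\<lambda>j. axis (i j) 1) * ndet k (\<lambda>l j. axis (i l) 1 \<bullet> e j)) =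
     (\<Sum>p | p permutes {..<k}. of_int (sign p) *
        (\<Sum>i \<in> ?I. (\<Prod>l<k. (e \<circ> p) l $ i l) * a (\<lambda>j. axis (i j) 1)))"
    unfolding ndet_def sum_distrib_left
    by (subst sum.swap) (simp add: inner_axis' mult_ac)
  also have "\<dots> = (\<Sum>p | p permutes {..<k}. of_int (sign p) * a (e \<circ> p))"
  proof (intro sum.cong refl arg_cong2[where f = "(*)"])
    fix p
    have "a (\<lambda>j. axis (i j) 1) = a (\<lambda>j. if j < k then axis (i j) 1 else (e \<circ> p) j)" for i :: "nat \<Rightarrow> 'n"
      by (rule alt_form_cong[OF a]) simp
    then show "(\<Sum>i \<in> ?I. (\<Prod>l<k. (e \<circ> p) l $ i l) * a (\<lambda>j. axis (i j) 1)) = a (e \<circ> p)"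
      using alt_form_expand[OF a order_refl, of "e \<circ> p"] by simp
  qed
  also have "\<dots> = (\<Sum>p | p permutes {..<k}. a e)"
  proof (intro sum.cong refl)
    fix p assume "p \<in> {p. p permutes {..<k}}"
    then have "of_int (sign p) * a (e \<circ> p) = of_int (sign p * sign p) * a e"
      using alt_form_permute[OF a, of p e] by (simp only: mem_Collect_eq of_int_mult mult.assoc)
    then show "of_int (sign p) * a (e \<circ> p) = a e" by (simp only: sign_idempotent of_int_1 mult_1)
  qed
  also have "\<dots> = fact k * a e"
    by (simp add: card_permutations[of "{..<k}" k])
  finally show ?thesis .
qed

text \<open>The exactness for constant forms. Multiplying by the orientation determinant of
  \<open>e\<close> and \<open>p\<close> turns each determinant in \<open>hodge\<close> into a Gram
  product, after which the sum over the axes collapses to \<open>a e\<close>. In this undivided form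
  it also covers degenerate \<open>e\<close> and \<open>p\<close>.\<close>

lemma hodge_mult_orient_det:
  fixes e p :: "nat \<Rightarrow> real^'n"
  assumes a: "alt_form k a" and "k \<le> CARD('n)"
    and orth: "\<And>i j. i < CARD('n) - k \<Longrightarrow> j < k \<Longrightarrow> p i \<bullet> e j = 0"
  shows "hodge k a p * orient_det (\<lambda>l. if l < k then e l else p (l - k)) =
         ndet (CARD('n) - k) (\<lambda>i j. p i \<bullet> p j) * a e"
proof -
  let ?D = "orient_det (\<lambda>l. if l < k then e l else p (l - k))"
  let ?G = "ndet (CARD('n) - k) (\<lambda>i j. p i \<bullet> p j)"
  have "orient_det (\<lambda>l. if l < k then axis (i l) 1 else p (l - k)) * ?D =
      ndet k (\<lambda>l j. axis (i l) 1 \<bullet> e j) * ?G" for i :: "nat \<Rightarrow> 'n"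
    by (rule orient_det_mult_orthogonal) (use assms in auto)
  then have "hodge k a p * ?D =
      (\<Sum>i \<in> PiE {..<k} (\<lambda>_. UNIV::'n set).
         a (\<lambda>j. axis (i j) 1) * ndet k (\<lambda>l j. axis (i l) 1 \<bullet> e j)) * ?G / fact k"
    unfolding hodge_def by (simp add: sum_distrib_right mult.assoc)
  then show ?thesis
    by (simp add: sum_alt_form_ndet[OF a])
qed

section \<open>Circumcenters and chains of simplices\<close>

text \<open>Needed because \<open>circumcenter\<close> is a definite description. With a vertex as
  origin, equidistance becomes the linear system \<open>y \<bullet> b = b \<bullet> b / 2\<close>
  over a basis of the direction space, which has one solution in that space.\<close>

lemma circumcenter_unique_exists:
  fixes s :: "(real^'n) set"
  assumes "s \<noteq> {}" and "\<not> affine_dependent s"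
  shows "\<exists>!c. c \<in> affine hull s \<and> (\<forall>v\<in>s. \<forall>w\<in>s. dist c v = dist c w)"
proof -
  obtain v0 where v0: "v0 \<in> s" using assms by blast
  define B where "B = (\<lambda>v. - v0 + v) ` (s - {v0})"
  have aff: "affine hull s = (\<lambda>x. v0 + x) ` span B"
    unfolding B_def by (rule affine_hull_span2[OF v0])
  have indep: "independent B"
    using affine_dependent_iff_dependent2[OF v0] assms unfolding B_def by blast
  have eq: "dist (v0 + y) (v0 + b) = dist (v0 + y) v0 \<longleftrightarrow> y \<bullet> b = b \<bullet> b / 2" for y b :: "real^'n"
    by (auto simp: dist_norm norm_eq algebra_simps inner_commute)
  have iff: "(\<forall>v\<in>s. \<forall>w\<in>s. dist (v0 + y) v = dist (v0 + y) w) \<longleftrightarrow> (\<forall>b\<in>B. y \<bullet> b = b \<bullet> b / 2)" for y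
  proof
    assume *: "\<forall>v\<in>s. \<forall>w\<in>s. dist (v0 + y) v = dist (v0 + y) w"
    show "\<forall>b\<in>B. y \<bullet> b = b \<bullet> b / 2"
    proof
      fix b assume "b \<in> B"
      then have "v0 + b \<in> s" by (auto simp: B_def)
      then show "y \<bullet> b = b \<bullet> b / 2" using * v0 eq by blast
    qed
  next
    assume *: "\<forall>b\<in>B. y \<bullet> b = b \<bullet> b / 2"
    have "dist (v0 + y) v = dist (v0 + y) v0" if "v \<in> s" for v
    proof (cases "v = v0")
      case False
      then have "- v0 + v \<in> B" using that by (auto simp: B_def)
      then show ?thesis using * eq[of y "- v0 + v"] by simp
    qed simp
    then show "\<forall>v\<in>s. \<forall>w\<in>s. dist (v0 + y) v = dist (v0 + y) w" by simp
  qed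
  obtain g :: "real^'n \<Rightarrow> real" where g: "linear g" "\<And>b. b \<in> B \<Longrightarrow> g b = b \<bullet> b / 2"
    using linear_independent_extend[OF indep, of "\<lambda>b. b \<bullet> b / 2"] by blast
  \<comment> \<open>\<open>adjoint g 1\<close> is the vector representing the functional
    \<open>g\<close>; its projection \<open>y\<close> to the span represents \<open>g\<close> there
    and stays in the direction space.\<close>
  obtain y z where yz: "y \<in> span B" "\<And>w. w \<in> span B \<Longrightarrow> orthogonal z w" "adjoint g 1 = y + z"
    using orthogonal_subspace_decomp_exists[of B "adjoint g 1"] by metis
  have y: "y \<bullet> b = b \<bullet> b / 2" if "b \<in> B" for b
  proof -
    have "b \<bullet> (y + z) = g b" using adjoint_works[OF g(1), of b 1] yz(3) by simp
    moreover have "z \<bullet> b = 0" using yz(2)[OF span_base[OF that]] by (simp add: orthogonal_def)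
    ultimately show ?thesis using g(2)[OF that] by (simp add: inner_commute inner_add_right)
  qed
  show ?thesis
  proof (rule ex1I[of _ "v0 + y"])
    show "v0 + y \<in> affine hull s \<and> (\<forall>v\<in>s. \<forall>w\<in>s. dist (v0 + y) v = dist (v0 + y) w)"
      using yz(1) y iff by (auto simp: aff)
    fix c assume c: "c \<in> affine hull s \<and> (\<forall>v\<in>s. \<forall>w\<in>s. dist c v = dist c w)"
    then obtain x where x: "x \<in> span B" "c = v0 + x" by (auto simp: aff)
    then have "x \<bullet> b = y \<bullet> b" if "b \<in> B" for b
    proof -
      have "x \<bullet> b = b \<bullet> b / 2" using c x(2) iff[of x] that by blast
      then show ?thesis using y[OF that] by linarith
    qed
    then have "orthogonal (x - y) b" if "b \<in> B" for b
      using that by (simp add: orthogonal_def inner_diff_left)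
    then have "orthogonal (x - y) (x - y)"
      using orthogonal_to_span[of "x - y" B "x - y"] x(1) yz(1) span_diff by blast
    then show "c = v0 + y" using x by (simp add: orthogonal_def)
  qed
qed

lemma circumcenter_equidistant:
  fixes s :: "(real^'n) set"
  assumes "s \<noteq> {}" "\<not> affine_dependent s" "v \<in> s" "w \<in> s"
  shows "dist (circumcenter s) v = dist (circumcenter s) w"
  using theI'[OF circumcenter_unique_exists[OF assms(1,2)]] assms(3,4)
  unfolding circumcenter_def by blast

text \<open>Both circumcenters are equidistant from \<open>v\<close> and \<open>w\<close>, so both
  lie in their bisecting hyperplane, which has normal \<open>v - w\<close>.\<close>

lemma circumcenter_diff_orthogonal:
  fixes s t :: "(real^'n) set"
  assumes "\<not> affine_dependent t" "s \<subseteq> t" "v \<in> s" "w \<in> s"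
  shows "(circumcenter t - circumcenter s) \<bullet> (v - w) = 0"
proof -
  have s: "\<not> affine_dependent s" using assms affine_independent_subset by blast
  have "dist (circumcenter s) v = dist (circumcenter s) w"
    using assms(3) by (intro circumcenter_equidistant[OF _ s assms(3,4)]) blast
  moreover have "dist (circumcenter t) v = dist (circumcenter t) w"
    using assms(2-4) by (intro circumcenter_equidistant[OF _ assms(1)]) blast+
  ultimately show ?thesis
    by (simp add: dist_norm norm_eq algebra_simps inner_commute)
qed

section \<open>Relative interiors and the points of open dual pieces\<close>

text \<open>The common point lies in the face spanned by \<open>s \<inter> t\<close>; a face that
  meets the relative interior is the whole simplex, and comparing extreme points gives
  \<open>s \<subseteq> t\<close>. The rest is symmetry.\<close>

lemma rel_interior_simplices_disjoint:
  assumes K: "simplicial_complex K" and st: "s \<in> K" "t \<in> K"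
    and x: "x \<in> rel_interior (convex hull s)" "x \<in> rel_interior (convex hull t)"
  shows "s = t"
proof -
  have sub: "s \<subseteq> t"
    if "s \<in> K" "t \<in> K" "x \<in> rel_interior (convex hull s)" "x \<in> rel_interior (convex hull t)" for s t
  proof -
    have ind: "\<not> affine_dependent s"
      using K \<open>s \<in> K\<close> unfolding simplicial_complex_def by meson
    have int: "convex hull s \<inter> convex hull t = convex hull (s \<inter> t)"
      using K \<open>s \<in> K\<close> \<open>t \<in> K\<close> unfolding simplicial_complex_def by meson
    have face: "convex hull (s \<inter> t) face_of convex hull s"
      using face_of_convex_hull_affine_independent[OF ind] by blast
    have "x \<in> convex hull (s \<inter> t)"
      using that(3,4) rel_interior_subset unfolding int[symmetric] by blast
    then have "convex hull (s \<inter> t) = convex hull s"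
      using face_of_disjoint_rel_interior[OF face] that(3) by blast
    then have "v \<in> s \<inter> t" if "v \<in> s" for v
      using extreme_point_of_convex_hull_affine_independent[OF ind, of v] that
        extreme_point_of_convex_hull[of v "s \<inter> t"] by simp
    then show ?thesis by blast
  qed
  show ?thesis using sub[OF st x] sub[OF st(2,1) x(2,1)] by blast
qed

lemma strict_chain_mono:
  fixes ch :: "nat \<Rightarrow> 'a set"
  assumes "\<And>j. j < m \<Longrightarrow> ch j \<subset> ch (Suc j)" "i \<le> j" "j \<le> m"
  shows "ch i \<subseteq> ch j"
  using assms(2,3)
proof (induction j rule: dec_induct)
  case (step j)
  then show ?case using assms(1)[of j] by auto
qed simp

lemma circumcenter_in_chain_top:
  fixes ch :: "nat \<Rightarrow> (real^'n) set"
  assumes "well_centered K" and "\<And>j. j \<le> m \<Longrightarrow> ch j \<in> K" and "\<And>j. j < m \<Longrightarrow> ch j \<subset> ch (Suc j)"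
    and "j \<le> m"
  shows "circumcenter (ch j) \<in> convex hull (ch m)"
proof -
  have "circumcenter (ch j) \<in> convex hull (ch j)"
    using assms rel_interior_subset unfolding well_centered_def by blast
  also have "\<dots> \<subseteq> convex hull (ch m)"
    using strict_chain_mono[of m ch j m, OF assms(3)] assms(4) by (intro hull_mono) auto
  finally show ?thesis .
qed

lemma chain_point_in_convex_hull:
  assumes "well_centered K" and "\<And>j. j \<le> m \<Longrightarrow> ch j \<in> K" and "\<And>j. j < m \<Longrightarrow> ch j \<subset> ch (Suc j)"
    and "\<And>j. j \<le> m \<Longrightarrow> 0 \<le> b j" and "(\<Sum>j\<le>m. b j) = 1"
  shows "(\<Sum>j\<le>m. b j *\<^sub>R circumcenter (ch j)) \<in> convex hull (ch m)"
proof (rule convex_sum)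
  fix j assume "j \<in> {..m}"
  then show "circumcenter (ch j) \<in> convex hull (ch m)"
    using circumcenter_in_chain_top[of K m ch j, OF assms(1-3)] by simp
qed (use assms in auto)

text \<open>Induction step for chains: the last point is separated, and the remaining weights are
  rescaled to sum 1.\<close>

lemma chain_split:
  fixes f :: "nat \<Rightarrow> 'a::real_vector"
  assumes "\<And>j. j \<le> Suc m \<Longrightarrow> 0 < b j" and "(\<Sum>j\<le>Suc m. b j) = (1::real)"
  shows "b (Suc m) < 1" and "(\<Sum>j\<le>m. b j / (1 - b (Suc m))) = 1"
    and "(\<Sum>j\<le>Suc m. b j *\<^sub>R f j) = b (Suc m) *\<^sub>R f (Suc m) +
      (1 - b (Suc m)) *\<^sub>R (\<Sum>j\<le>m. (b j / (1 - b (Suc m))) *\<^sub>R f j)"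
proof -
  have "0 < (\<Sum>j\<le>m. b j)" by (rule sum_pos) (use assms in auto)
  then show *: "b (Suc m) < 1" using assms(2) by simp
  show "(\<Sum>j\<le>m. b j / (1 - b (Suc m))) = 1"
    using assms(2) * by (simp add: sum_divide_distrib[symmetric] field_simps)
  show "(\<Sum>j\<le>Suc m. b j *\<^sub>R f j) = b (Suc m) *\<^sub>R f (Suc m) +
      (1 - b (Suc m)) *\<^sub>R (\<Sum>j\<le>m. (b j / (1 - b (Suc m))) *\<^sub>R f j)"
    using * by (simp add: scaleR_sum_right)
qed

text \<open>The positive weight of the last circumcenter, an interior point by well-centeredness,
  pulls the point off the boundary. So a point of an open dual piece determines the top simplex of
  its chain.\<close>

lemma chain_point_in_rel_interior:
  assumes wc: "well_centered K" and ch: "\<And>j. j \<le> m \<Longrightarrow> ch j \<in> K" "\<And>j. j < m \<Longrightarrow> ch j \<subset> ch (Suc j)"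
    and b: "\<And>j. j \<le> m \<Longrightarrow> 0 < b j" "(\<Sum>j\<le>m. b j) = 1"
  shows "(\<Sum>j\<le>m. b j *\<^sub>R circumcenter (ch j)) \<in> rel_interior (convex hull (ch m))"
proof -
  have c: "circumcenter (ch m) \<in> rel_interior (convex hull (ch m))"
    using wc ch unfolding well_centered_def by blast
  show ?thesis
  proof (cases m)
    case 0
    then show ?thesis using c b by simp
  next
    case (Suc m')
    let ?y = "\<Sum>j\<le>m'. (b j / (1 - b m)) *\<^sub>R circumcenter (ch j)"
    note split = chain_split(1,2)[of m' b, folded Suc, OF b]
      chain_split(3)[of m' b, folded Suc, OF b, of "\<lambda>j. circumcenter (ch j)"]
    have "?y \<in> convex hull (ch m')"
      using split b(1) Suc by (intro chain_point_in_convex_hull[OF wc] ch) (auto simp: less_imp_le)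
    then have y: "?y \<in> convex hull (ch m)"
      using hull_mono[of "ch m'" "ch m"] ch(2)[of m'] Suc by blast
    have "?y - b m *\<^sub>R (?y - circumcenter (ch m)) \<in> rel_interior (convex hull (ch m))"
      using split b(1)[of m] by (intro rel_interior_convex_shrink[OF _ c y]) auto
    then show ?thesis by (simp only: split(3)) (simp add: algebra_simps)
  qed
qed

text \<open>The ray from the circumcenter of the top simplex through a point of an open dual piece leaves
  the simplex through the facet preceding it in the chain; so the point determines the chain.\<close>
lemma chain_unique:
  assumes K: "simplicial_complex K" and wc: "well_centered K"
    and ch: "\<And>j. j \<le> m \<Longrightarrow> ch j \<in> K" "\<And>j. j < m \<Longrightarrow> ch j \<subset> ch (Suc j)"
    and ch': "\<And>j. j \<le> m \<Longrightarrow> ch' j \<in> K" "\<And>j. j < m \<Longrightarrow> ch' j \<subset> ch' (Suc j)"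
    and b: "\<And>j. j \<le> m \<Longrightarrow> 0 < b j" "(\<Sum>j\<le>m. b j) = 1"
    and b': "\<And>j. j \<le> m \<Longrightarrow> 0 < b' j" "(\<Sum>j\<le>m. b' j) = 1"
    and eq: "(\<Sum>j\<le>m. b j *\<^sub>R circumcenter (ch j)) = (\<Sum>j\<le>m. b' j *\<^sub>R circumcenter (ch' j))"
    and "j \<le> m"
  shows "ch j = ch' j"
  using ch ch' b b' eq \<open>j \<le> m\<close>
proof (induction m arbitrary: b b' j)
  case 0
  have "ch 0 = ch' 0"
  proof (rule rel_interior_simplices_disjoint[OF K])
    show "(\<Sum>j\<le>0. b j *\<^sub>R circumcenter (ch j)) \<in> rel_interior (convex hull ch 0)"
      by (rule chain_point_in_rel_interior[OF wc]) (use 0 in auto)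
    show "(\<Sum>j\<le>0. b j *\<^sub>R circumcenter (ch j)) \<in> rel_interior (convex hull ch' 0)"
      unfolding 0(9) by (rule chain_point_in_rel_interior[OF wc]) (use 0 in auto)
  qed (use 0 in auto)
  then show ?case using 0 by simp
next
  case (Suc m)
  let ?c = "\<lambda>j. circumcenter (ch j)" and ?c' = "\<lambda>j. circumcenter (ch' j)"
  have top: "ch (Suc m) = ch' (Suc m)"
  proof (rule rel_interior_simplices_disjoint[OF K])
    show "(\<Sum>j\<le>Suc m. b j *\<^sub>R ?c j) \<in> rel_interior (convex hull ch (Suc m))"
      by (rule chain_point_in_rel_interior[OF wc]) (use Suc.prems(1,2,5,6) in auto)
    show "(\<Sum>j\<le>Suc m. b j *\<^sub>R ?c j) \<in> rel_interior (convex hull ch' (Suc m))"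
      unfolding Suc.prems(9)
      by (rule chain_point_in_rel_interior[OF wc]) (use Suc.prems(3,4,7,8) in auto)
  qed (use Suc.prems(1,3) in auto)
  define \<beta> \<beta>' where "\<beta> = b (Suc m)" and "\<beta>' = b' (Suc m)"
  define y y' where "y = (\<Sum>j\<le>m. (b j / (1 - \<beta>)) *\<^sub>R ?c j)"
    and "y' = (\<Sum>j\<le>m. (b' j / (1 - \<beta>')) *\<^sub>R ?c' j)"
  note sp = chain_split(1,2)[of m b, OF Suc.prems(5,6), folded \<beta>_def]
    chain_split(3)[of m b, OF Suc.prems(5,6), of ?c, folded \<beta>_def, folded y_def]
  note sp' = chain_split(1,2)[of m b', OF Suc.prems(7,8), folded \<beta>'_def]
    chain_split(3)[of m b', OF Suc.prems(7,8), of ?c', folded \<beta>'_def, folded y'_def]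
  have y: "y \<in> rel_interior (convex hull (ch m))"
    unfolding y_def using sp Suc.prems by (intro chain_point_in_rel_interior[OF wc]) auto
  have y': "y' \<in> rel_interior (convex hull (ch' m))"
    unfolding y'_def using sp' Suc.prems by (intro chain_point_in_rel_interior[OF wc]) auto
  have eq: "\<beta> *\<^sub>R ?c (Suc m) + (1 - \<beta>) *\<^sub>R y = \<beta>' *\<^sub>R ?c (Suc m) + (1 - \<beta>') *\<^sub>R y'"
    using sp(3) sp'(3) Suc.prems(9) top by simp
  \<comment> \<open>With \<open>\<beta> < \<beta>'\<close>, the point \<open>y\<close> lies strictly
    between \<open>y'\<close> and the circumcenter, hence in the relative interior of the top
    simplex; but it also lies in that of a proper face. The claim is kept general so that it applies
    with both chains exchanged.\<close>
  have contra: False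
    if "\<beta> < \<beta>'" "\<beta> < 1" "\<beta>' < 1" and s: "s \<in> K" "t \<in> K" "t \<subset> s" "t' \<subseteq> s"
      and y: "y \<in> rel_interior (convex hull t)" "y' \<in> rel_interior (convex hull t')"
      and eq: "\<beta> *\<^sub>R circumcenter s + (1 - \<beta>) *\<^sub>R y = \<beta>' *\<^sub>R circumcenter s + (1 - \<beta>') *\<^sub>R y'"
    for \<beta> \<beta>' :: real and s t t' :: "(real^'a) set" and y y'
  proof -
    define \<epsilon> where "\<epsilon> = (\<beta>' - \<beta>) / (1 - \<beta>)"
    have "(1 - \<beta>) *\<^sub>R y = (\<beta>' - \<beta>) *\<^sub>R circumcenter s + (1 - \<beta>') *\<^sub>R y'"
      using eq by (simp add: algebra_simps)
    also have "\<dots> = (1 - \<beta>) *\<^sub>R (y' - \<epsilon> *\<^sub>R (y' - circumcenter s))"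
    proof -
      have "(1 - \<beta>) * \<epsilon> = \<beta>' - \<beta>" using that by (simp add: \<epsilon>_def)
      then show ?thesis by (simp add: scaleR_diff_right scaleR_diff_left)
    qed
    finally have "y = y' - \<epsilon> *\<^sub>R (y' - circumcenter s)" using that by simp
    also have "\<dots> \<in> rel_interior (convex hull s)"
    proof (rule rel_interior_convex_shrink)
      show "circumcenter s \<in> rel_interior (convex hull s)"
        using wc s unfolding well_centered_def by blast
      show "y' \<in> convex hull s"
        using y(2) rel_interior_subset hull_mono[OF s(4)] by blast
      show "0 < \<epsilon>" "\<epsilon> \<le> 1" using that by (auto simp: \<epsilon>_def)
    qed simp
    finally show False
      using rel_interior_simplices_disjoint[OF K s(1,2) _ y(1)] s by blast
  qed
  have sub: "ch m \<subset> ch (Suc m)" "ch' m \<subset> ch (Suc m)" and inK: "ch m \<in> K" "ch' m \<in> K" "ch (Suc m) \<in> K"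
    using Suc.prems(1)[of m] Suc.prems(1)[of "Suc m"] Suc.prems(2)[of m] Suc.prems(3)[of m]
      Suc.prems(4)[of m] unfolding top by auto
  have "\<not> \<beta> < \<beta>'"
    using contra[OF _ sp(1) sp'(1) inK(3,1) sub(1) _ y y' eq] sub by blast
  moreover have "\<not> \<beta>' < \<beta>"
    using contra[OF _ sp'(1) sp(1) inK(3,2) sub(2) _ y' y eq[symmetric]] sub by blast
  ultimately have "\<beta> = \<beta>'" by simp
  then have "y = y'" using eq sp(1) by simp
  show ?case
  proof (cases "j = Suc m")
    case True
    then show ?thesis using top by simp
  next
    case False
    then have "j \<le> m" using Suc.prems by simp
    show ?thesis
    proof (rule Suc.IH)
      show "(\<Sum>j\<le>m. (b j / (1 - \<beta>)) *\<^sub>R ?c j) = (\<Sum>j\<le>m. (b' j / (1 - \<beta>')) *\<^sub>R ?c' j)"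
        using \<open>y = y'\<close> by (simp add: y_def y'_def)
    qed (use Suc.prems sp sp' \<open>j \<le> m\<close> in auto)
  qed
qed

section \<open>Diameter and inradius of a simplex\<close>

lemma dist_le_max_edge:
  fixes x y :: "real^'n"
  assumes K: "simplicial_complex K" and "0 \<le> max_edge K" and s: "s \<in> K"
    and xy: "x \<in> convex hull s" "y \<in> convex hull s"
  shows "dist x y \<le> max_edge K"
proof -
  have s': "finite s" "s \<noteq> {}" using K s unfolding simplicial_complex_def by blast+
  then obtain u v where uv: "u \<in> s" "v \<in> s" "norm (x - y) \<le> norm (u - v)"
    using simplex_extremal_le[OF s'] xy by metis
  \<comment> \<open>The diameter is attained at two vertices, which span an edge of \<open>K\<close>
    unless they coincide. In that case nonnegativity of \<open>max_edge K\<close> decides; without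
    any edge it would be a \<open>Max\<close> over the empty set.\<close>
  have "dist u v \<le> max_edge K"
  proof (cases "u = v")
    case False
    have "finite (\<Union>K)" using K unfolding simplicial_complex_def by (meson finite_Union)
    moreover have "{dist a b | a b. {a, b} \<in> K \<and> a \<noteq> b} \<subseteq> (\<lambda>(a, b). dist a b) ` (\<Union>K \<times> \<Union>K)"
      by force
    ultimately have "finite {dist a b | a b. {a, b} \<in> K \<and> a \<noteq> b}"
      by (meson finite_SigmaI finite_imageI finite_subset)
    moreover have "{u, v} \<in> K"
      using K s uv unfolding simplicial_complex_def by (metis empty_subsetI insert_not_empty insert_subset)
    ultimately show ?thesis
      unfolding max_edge_def using False by (intro Max_ge) auto
  qed (use assms in simp)
  then show ?thesis using uv by (simp add: dist_norm)
qed

text \<open>From the center of an inscribed ball one can walk the full radius along an edge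
  direction without leaving the simplex. This takes two vertices: for a single one every radius
  qualifies and the supremum is meaningless.\<close>

lemma inradius_bounds:
  fixes s :: "(real^'n) set"
  assumes "finite s" "2 \<le> card s" and diam: "\<And>x y. x \<in> convex hull s \<Longrightarrow> y \<in> convex hull s \<Longrightarrow> dist x y \<le> d"
  shows "0 < inradius s" and "inradius s \<le> d"
proof -
  let ?R = "{r. 0 \<le> r \<and> (\<exists>c \<in> affine hull s. cball c r \<inter> affine hull s \<subseteq> convex hull s)}"
  obtain a b where ab: "a \<in> s" "b \<in> s" "a \<noteq> b"
    using assms by (metis card_le_Suc0_iff_eq not_less_eq_eq numeral_2_eq_2)
  have le: "r \<le> d" if r: "r \<in> ?R" for r
  proof -
    obtain c where c: "c \<in> affine hull s" "cball c r \<inter> affine hull s \<subseteq> convex hull s" "0 \<le> r"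
      using r by blast
    let ?x = "c + (r / norm (b - a)) *\<^sub>R (b - a)"
    have "?x \<in> affine hull s"
      using mem_affine_3_minus[OF affine_affine_hull c(1) hull_inc hull_inc, OF ab(2,1)] .
    moreover have dist: "dist c ?x = r" using ab c by (simp add: dist_norm)
    ultimately have "?x \<in> convex hull s" using c by auto
    moreover have "c \<in> convex hull s" using c by auto
    ultimately show ?thesis using diam dist by metis
  qed
  have "rel_interior (convex hull s) \<noteq> {}"
    using ab by (subst rel_interior_eq_empty) auto
  then obtain c e where ce: "c \<in> convex hull s" "e > 0" "cball c e \<inter> affine hull s \<subseteq> convex hull s"
    by (auto simp: mem_rel_interior_cball)
  then have e: "e \<in> ?R" using convex_hull_subset_affine_hull by auto
  have "e \<le> inradius s"
    unfolding inradius_def by (rule cSup_upper[OF e]) (use le in \<open>rule bdd_aboveI\<close>)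
  then show "0 < inradius s" using ce by simp
  show "inradius s \<le> d"
    unfolding inradius_def using e le by (intro cSup_least) auto
qed

section \<open>Volume of disjoint simplices\<close>

text \<open>The linear change of variables formula for Lebesgue measure is available only for vectors
  indexed by a wellordered type, so a wellordered copy of the index type is needed.\<close>
typedef ('n::finite) coord_index = "{..<CARD('n)}"
  by (rule exI[of _ 0]) simp

lemma bij_Abs_coord_index:
  "bij_betw Abs_coord_index {..<CARD('n::finite)} (UNIV :: 'n coord_index set)"
  by (rule bij_betwI[where g = Rep_coord_index])
    (auto simp: Abs_coord_index_inverse Rep_coord_index_inverse Rep_coord_index[simplified])

instance coord_index :: (finite) finite
  by standard (metis bij_Abs_coord_index bij_betw_finite finite_lessThan)

instantiation coord_index :: (finite) wellorder
begin

definition "a \<le> b \<longleftrightarrow> Rep_coord_index a \<le> Rep_coord_index b"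

definition "a < b \<longleftrightarrow> Rep_coord_index a < Rep_coord_index b"

instance
proof
  fix P :: "'a coord_index \<Rightarrow> bool" and a
  assume step: "\<And>x. (\<And>y. y < x \<Longrightarrow> P y) \<Longrightarrow> P x"
  show "P a"
    by (induction a rule: measure_induct_rule[of Rep_coord_index])
      (rule step, simp add: less_coord_index_def)
qed (auto simp: less_eq_coord_index_def less_coord_index_def Rep_coord_index_inject)

end

lemma card_coord_index: "CARD('n::finite coord_index) = CARD('n)"
  using bij_betw_same_card[OF bij_Abs_coord_index[where 'n = 'n]] by simp

lemma sum_coord_index:
  "(\<Sum>j\<in>UNIV. f (Rep_coord_index (j :: 'n::finite coord_index))) = (\<Sum>l<CARD('n). f l)"
  using sum.reindex_bij_betw[OF bij_Abs_coord_index[where 'n = 'n], of "\<lambda>j. f (Rep_coord_index j)"]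
  by (simp add: Abs_coord_index_inverse)

text \<open>Coordinates listed in the order of \<open>coord_enum\<close>. The map is isometric, so
  balls and volumes may be compared in the wellordered copy.\<close>

definition reindex_vec :: "real^'n \<Rightarrow> real^('n coord_index)" where
  "reindex_vec v = (\<chi> j. v $ coord_enum (Rep_coord_index j))"

lemma linear_reindex_vec: "linear reindex_vec"
  by (rule linearI) (simp_all add: reindex_vec_def vec_eq_iff)

lemma norm_reindex_vec: "norm (reindex_vec v) = norm v"
proof -
  have "(\<Sum>j\<in>UNIV. (reindex_vec v $ j)\<^sup>2) = (\<Sum>l<CARD('a). (v $ coord_enum l)\<^sup>2)"
    unfolding reindex_vec_def by (simp add: sum_coord_index[of "\<lambda>l. (v $ coord_enum l)\<^sup>2"])
  also have "\<dots> = (\<Sum>c\<in>UNIV. (v $ c)\<^sup>2)"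
    by (rule sum.reindex_bij_betw[OF bij_betw_coord_enum])
  finally show ?thesis
    by (simp add: norm_vec_def L2_set_def)
qed

lemma reindex_vec_eq_iff: "reindex_vec v = reindex_vec w \<longleftrightarrow> v = w"
  using norm_reindex_vec[of "v - w"] linear_diff[OF linear_reindex_vec, of v w] by auto

text \<open>Strict inequalities, so that the images belonging to touching pieces are truly
  disjoint.\<close>

definition open_std_simplex :: "(real^'m) set" where
  "open_std_simplex = {x. (\<forall>i. 0 < x $ i) \<and> (\<Sum>i\<in>UNIV. x $ i) < 1}"

lemma open_std_simplex_lmeasurable: "(open_std_simplex :: (real^'m) set) \<in> lmeasurable"
  and measure_open_std_simplex_pos: "0 < measure lebesgue (open_std_simplex :: (real^'m) set)"
proof -
  let ?O = "open_std_simplex :: (real^'m) set"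
  have eq: "?O = (\<Inter>i\<in>UNIV. {x. 0 < x $ i}) \<inter> {x. (\<Sum>i\<in>UNIV. x $ i) < 1}"
    by (auto simp: open_std_simplex_def)
  have "open ?O"
    unfolding eq by (intro open_Int open_INT ballI open_Collect_less continuous_intros) simp_all
  have "norm x \<le> 1" if "x \<in> ?O" for x
  proof -
    have "norm x \<le> (\<Sum>i\<in>UNIV. \<bar>x $ i\<bar>)" by (rule norm_le_l1_cart)
    also have "\<dots> = (\<Sum>i\<in>UNIV. x $ i)"
      using that by (intro sum.cong) (auto simp: open_std_simplex_def less_imp_le)
    finally show ?thesis using that by (simp add: open_std_simplex_def)
  qed
  then have "bounded ?O" by (auto simp: bounded_iff)
  then show meas: "?O \<in> lmeasurable"
    using \<open>open ?O\<close> by (simp add: lmeasurable_open)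
  have "(\<chi> i. 1 / (real CARD('m) + 1)) \<in> ?O"
    by (simp add: open_std_simplex_def field_simps)
  then have "\<not> negligible ?O"
    using \<open>open ?O\<close> open_not_negligible by blast
  then show "0 < measure lebesgue ?O"
    using meas by (simp add: negligible_iff_measure order_less_le)
qed

text \<open>A packing bound. The linear maps sending the axes to the vectors \<open>w i\<close>
  carry the open standard simplex to disjoint simplices with a corner at 0. Each has volume
  \<open>\<bar>orient_det (w i)\<bar>\<close> times that of the standard simplex, and all of them
  lie in the ball of radius \<open>r\<close>.\<close>

lemma sum_orient_det_le:
  fixes w :: "'i \<Rightarrow> nat \<Rightarrow> real^'n"
  assumes "finite I" "0 \<le> r" and bound: "\<And>i l. i \<in> I \<Longrightarrow> l < CARD('n) \<Longrightarrow> norm (w i l) \<le> r"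
    and disj: "\<And>i i' x x'. i \<in> I \<Longrightarrow> i' \<in> I \<Longrightarrow>
      (\<And>l. l < CARD('n) \<Longrightarrow> 0 < x l) \<Longrightarrow> (\<Sum>l<CARD('n). x l) < 1 \<Longrightarrow>
      (\<And>l. l < CARD('n) \<Longrightarrow> 0 < x' l) \<Longrightarrow> (\<Sum>l<CARD('n). x' l) < 1 \<Longrightarrow>
      (\<Sum>l<CARD('n). x l *\<^sub>R w i l) = (\<Sum>l<CARD('n). x' l *\<^sub>R w i' l) \<Longrightarrow> i = i'"
  shows "(\<Sum>i\<in>I. \<bar>orient_det (w i)\<bar>) \<le>
    unit_ball_vol (real CARD('n)) / measure lebesgue (open_std_simplex :: (real^('n coord_index)) set) * r ^ CARD('n)"
proof -
  let ?O = "open_std_simplex :: (real^('n coord_index)) set"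
  define f where "f i x = (\<Sum>j\<in>UNIV. x $ j *\<^sub>R reindex_vec (w i (Rep_coord_index j)))"
    for i and x :: "real^('n coord_index)"
  have lin: "linear (f i)" for i
    unfolding f_def by (intro linear_compose_sum ballI linearI) (simp_all add: algebra_simps)
  have f_eq: "f i x = reindex_vec (\<Sum>l<CARD('n). x $ Abs_coord_index l *\<^sub>R w i l)" for i x
    by (simp add: f_def linear_sum[OF linear_reindex_vec] linear_scale[OF linear_reindex_vec]
        sum_coord_index[symmetric] Rep_coord_index_inverse)
  have det: "\<bar>det (matrix (f i))\<bar> = \<bar>orient_det (w i)\<bar>" for i
  proof -
    have "f i (axis b 1) = reindex_vec (w i (Rep_coord_index b))" for b
      by (simp add: f_def axis_def if_distrib[of "\<lambda>c. c *\<^sub>R _"] cong: if_cong)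
    then have "matrix (f i) = transpose (\<chi> a b. w i (Rep_coord_index a) $ coord_enum (Rep_coord_index b))"
      by (simp add: matrix_def transpose_def vec_eq_iff reindex_vec_def)
    moreover have "orient_det (w i) = det (\<chi> (a :: 'n coord_index) (b :: 'n coord_index).
        w i (Rep_coord_index a) $ coord_enum (Rep_coord_index b))"
      unfolding orient_det_def ndet_eq_det[OF bij_Abs_coord_index, symmetric]
      by (rule ndet_cong) (simp add: Abs_coord_index_inverse)
    ultimately show ?thesis by (simp add: det_transpose)
  qed
  have meas: "f i ` ?O \<in> lmeasurable" for i
    by (rule measurable_linear_image[OF lin open_std_simplex_lmeasurable])
  have measure: "measure lebesgue (f i ` ?O) = \<bar>orient_det (w i)\<bar> * measure lebesgue ?O" for i
    using measure_linear_image[OF lin open_std_simplex_lmeasurable] by (simp add: det)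
  have sub: "f i ` ?O \<subseteq> cball 0 r" if "i \<in> I" for i
  proof
    fix z assume "z \<in> f i ` ?O"
    then obtain x where x: "x \<in> ?O" "z = f i x" by blast
    have "norm z \<le> (\<Sum>j\<in>UNIV. norm (x $ j *\<^sub>R reindex_vec (w i (Rep_coord_index j))))"
      unfolding x f_def by (rule norm_sum)
    also have "\<dots> \<le> (\<Sum>j\<in>UNIV. x $ j * r)"
    proof (rule sum_mono)
      fix j :: "'n coord_index"
      have "0 < x $ j" using x by (simp add: open_std_simplex_def)
      then show "norm (x $ j *\<^sub>R reindex_vec (w i (Rep_coord_index j))) \<le> x $ j * r"
        using bound[OF that, of "Rep_coord_index j"] Rep_coord_index[of j] by (simp add: norm_reindex_vec)
    qed
    also have "\<dots> \<le> 1 * r"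
      unfolding sum_distrib_right[symmetric] using x \<open>0 \<le> r\<close>
      by (intro mult_right_mono) (auto simp: open_std_simplex_def)
    finally show "z \<in> cball 0 r" by simp
  qed
  have disjoint: "disjnt (f i ` ?O) (f i' ` ?O)" if "i \<in> I" "i' \<in> I" "i \<noteq> i'" for i i'
  proof (rule ccontr)
    assume "\<not> disjnt (f i ` ?O) (f i' ` ?O)"
    then obtain x x' where x: "x \<in> ?O" "x' \<in> ?O" "f i x = f i' x'"
      by (auto simp: disjnt_def)
    have pos: "0 < y $ Abs_coord_index l" "(\<Sum>l<CARD('n). y $ Abs_coord_index l) < 1" if "y \<in> ?O" for y l
      using that by (auto simp: open_std_simplex_def sum_coord_index[symmetric] Rep_coord_index_inverse)
    have "i = i'"
      using x pos by (intro disj[of i i' "\<lambda>l. x $ Abs_coord_index l" "\<lambda>l. x' $ Abs_coord_index l"] that)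
        (auto simp: f_eq reindex_vec_eq_iff)
    then show False using that by simp
  qed
  have "(\<Sum>i\<in>I. \<bar>orient_det (w i)\<bar>) * measure lebesgue ?O = (\<Sum>i\<in>I. measure lebesgue (f i ` ?O))"
    by (simp add: measure sum_distrib_right)
  also have "\<dots> = measure lebesgue (\<Union>i\<in>I. f i ` ?O)"
    using \<open>finite I\<close> meas disjoint
    by (intro measure_UNION'[symmetric]) (auto simp: pairwise_def)
  also have "\<dots> \<le> measure lebesgue (cball 0 r :: (real^('n coord_index)) set)"
    using sub meas \<open>finite I\<close> by (intro measure_mono_fmeasurable) (auto intro!: fmeasurableD)
  also have "\<dots> = unit_ball_vol (real CARD('n)) * r ^ CARD('n)"
    using content_cball[OF \<open>0 \<le> r\<close>, of "0 :: real^('n coord_index)"]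
    by (simp add: card_coord_index)
  finally show ?thesis
    using measure_open_std_simplex_pos[where 'm = "'n coord_index"] by (simp add: field_simps)
qed

section \<open>Averages over simplices\<close>

lemma sets_std_simplex [measurable]: "std_simplex m \<in> sets (Pi\<^sub>M {..<m} (\<lambda>_. lborel))"
  and emeasure_std_simplex_PiM:
    "emeasure (Pi\<^sub>M {..<m} (\<lambda>_. lborel)) (std_simplex m) = ennreal (1 / fact m)"
proof -
  let ?M = "Pi\<^sub>M {..<m} (\<lambda>_. lborel :: real measure)"
  have eq: "std_simplex m = {x. (\<forall>i\<in>{..<m}. 0 \<le> x i) \<and> sum x {..<m} \<le> 1} \<inter> space ?M"
    by (auto simp: std_simplex_def space_PiM)
  show "emeasure ?M (std_simplex m) = ennreal (1 / fact m)"
    unfolding eq by (subst emeasure_std_simplex_aux) auto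
  \<comment> \<open>A set that is not measurable would have \<open>emeasure\<close> 0 by
    convention.\<close>
  then show "std_simplex m \<in> sets ?M"
    by (metis emeasure_notin_sets ennreal_eq_0_iff fact_gt_zero not_le zero_less_divide_1_iff)
qed

text \<open>Passage to barycentric weights; the base point receives what the others leave.\<close>

lemma sum_shift_base:
  fixes q :: "nat \<Rightarrow> 'a::real_vector"
  shows "q 0 + (\<Sum>j<m. t j *\<^sub>R (q (Suc j) - q 0)) =
    (\<Sum>j\<le>m. (case j of 0 \<Rightarrow> 1 - (\<Sum>j<m. t j) | Suc i \<Rightarrow> t i) *\<^sub>R q j)"
  by (simp add: lessThan_Suc_atMost[symmetric] sum.lessThan_Suc_shift scaleR_diff_right sum_subtractf
      scaleR_sum_left[symmetric] scaleR_diff_left del: sum.lessThan_Suc)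

lemma simplex_map_mem_convex:
  assumes "convex S" and "\<And>j. j \<le> m \<Longrightarrow> q j \<in> S" and t: "t \<in> std_simplex m"
  shows "simplex_map m q t \<in> S"
  unfolding simplex_map_def sum_shift_base
proof (rule convex_sum)
  show "(\<Sum>j\<le>m. case j of 0 \<Rightarrow> 1 - (\<Sum>j<m. t j) | Suc i \<Rightarrow> t i) = 1"
    by (simp add: lessThan_Suc_atMost[symmetric] sum.lessThan_Suc_shift del: sum.lessThan_Suc)
qed (use assms in \<open>auto simp: std_simplex_def split: nat.split\<close>)

text \<open>\<open>fact m\<close> is the reciprocal volume of the standard simplex, so the
  expression is an average of \<open>F\<close>, whatever the shape of the image simplex.\<close>

lemma simplex_average_bound:
  fixes F :: "real^'n \<Rightarrow> real"
  assumes S: "compact S" and F: "continuous_on S F"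
    and t: "\<And>t. t \<in> std_simplex m \<Longrightarrow> simplex_map m q t \<in> S"
    and bound: "\<And>x. x \<in> S \<Longrightarrow> \<bar>F x - c\<bar> \<le> d"
  shows "\<bar>fact m * integral\<^sup>L (Pi\<^sub>M {..<m} (\<lambda>_. lborel))
            (\<lambda>t. indicator (std_simplex m) t * F (simplex_map m q t)) - c\<bar> \<le> d"
proof -
  let ?M = "Pi\<^sub>M {..<m} (\<lambda>_. lborel :: real measure)"
  let ?g = "\<lambda>t. indicator (std_simplex m) t * F (simplex_map m q t)"
  have fin: "emeasure ?M (std_simplex m) < \<infinity>"
    unfolding emeasure_std_simplex_PiM by simp
  have const: "integrable ?M (\<lambda>t. indicator (std_simplex m) t * a)" for a :: real
    using fin by (intro integrable_mult_left integrable_real_indicator) auto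
  have const_int: "(\<integral>t. indicator (std_simplex m) t * a \<partial>?M) = a / fact m" for a :: real
    using fin by (simp add: measure_def emeasure_std_simplex_PiM)
  have q: "simplex_map m q \<in> borel_measurable ?M"
    unfolding simplex_map_def[abs_def] by measurable
  \<comment> \<open>\<open>F\<close> is continuous only on \<open>S\<close>. Cutting it off outside
    makes it Borel and changes nothing under the integral, since the parametrisation stays in
    \<open>S\<close>.\<close>
  have F': "(\<lambda>x. indicator S x *\<^sub>R F x) \<in> borel_measurable borel"
    using S F by (intro borel_measurable_continuous_on_indicator) (auto intro: borel_closed compact_imp_closed)
  have g_eq: "?g = (\<lambda>t. indicator (std_simplex m) t *\<^sub>R (indicator S (simplex_map m q t) *\<^sub>R F (simplex_map m q t)))"
    using t by (auto simp: fun_eq_iff indicator_def)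
  have g: "integrable ?M ?g"
    unfolding g_eq
  proof (rule integrableI_bounded_set_indicator[where B = "\<bar>c\<bar> + \<bar>d\<bar>"])
    show "(\<lambda>t. indicator S (simplex_map m q t) *\<^sub>R F (simplex_map m q t)) \<in> borel_measurable ?M"
      using measurable_compose[OF q F'] by simp
    show "AE t in ?M. t \<in> std_simplex m \<longrightarrow>
        norm (indicator S (simplex_map m q t) *\<^sub>R F (simplex_map m q t)) \<le> \<bar>c\<bar> + \<bar>d\<bar>"
      using bound t by (intro AE_I2) (fastforce simp: indicator_def)
  qed (use fin in auto)
  have "integral\<^sup>L ?M ?g \<le> (\<integral>t. indicator (std_simplex m) t * (c + d) \<partial>?M)"
    using bound t by (intro integral_mono[OF g const]) (fastforce simp: indicator_def abs_le_iff)
  moreover have "(\<integral>t. indicator (std_simplex m) t * (c - d) \<partial>?M) \<le> integral\<^sup>L ?M ?g"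
    using bound t by (intro integral_mono[OF const g]) (fastforce simp: indicator_def abs_le_iff)
  ultimately show ?thesis
    unfolding const_int by (simp add: field_simps abs_le_iff)
qed

text \<open>Compactness bounds the derivative, and convexity provides the segments for the mean
  value inequality. \<open>L\<close> depends on \<open>v\<close>; it is later summed over the
  finitely many tuples of axes.\<close>

lemma C1_form_lipschitz:
  fixes P :: "(real^'n) set"
  assumes "C1_form P k \<omega>" and "convex P" "compact P"
  obtains L where "0 \<le> L" "\<And>x y. x \<in> P \<Longrightarrow> y \<in> P \<Longrightarrow> \<bar>\<omega> x v - \<omega> y v\<bar> \<le> L * dist x y"
proof -
  obtain U and D :: "(real^'n) \<Rightarrow> ((real^'n) \<Rightarrow>\<^sub>L real)" where U: "P \<subseteq> U"
    and D: "\<And>x. x \<in> U \<Longrightarrow> ((\<lambda>y. \<omega> y v) has_derivative blinfun_apply (D x)) (at x)" "continuous_on U D"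
    using assms(1) unfolding C1_form_def by metis
  have "compact (D ` P)"
    using D(2) U \<open>compact P\<close> by (intro compact_continuous_image) (auto intro: continuous_on_subset)
  then obtain L where L: "0 < L" "\<And>x. x \<in> P \<Longrightarrow> norm (D x) \<le> L"
    using compact_imp_bounded bounded_pos by (metis image_eqI)
  show ?thesis
  proof
    fix x y assume xy: "x \<in> P" "y \<in> P"
    have "norm (\<omega> x v - \<omega> y v) \<le> L * norm (x - y)"
    proof (rule differentiable_bound[OF \<open>convex P\<close> _ _ xy])
      fix z assume z: "z \<in> P"
      show "((\<lambda>y. \<omega> y v) has_derivative blinfun_apply (D z)) (at z within P)"
        using D(1) z U by (meson has_derivative_at_withinI subsetD)
      show "onorm (blinfun_apply (D z)) \<le> L"
        using L(2)[OF z] by (simp add: norm_blinfun.rep_eq)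
    qed
    then show "\<bar>\<omega> x v - \<omega> y v\<bar> \<le> L * dist x y" by (simp add: dist_norm)
  qed (use L in simp)
qed

section \<open>Size of the Hodge star on vectors orthogonal to a simplex\<close>

lemma ndet_diagonal: "ndet m (\<lambda>i j. if i = j then c else 0) = c ^ m"
proof -
  have "(\<Prod>i<m. if i = p i then c else 0) = 0" if "p permutes {..<m}" "p \<noteq> id" for p
  proof -
    obtain i where "p i \<noteq> i" using \<open>p \<noteq> id\<close> by (auto simp: fun_eq_iff)
    moreover from this have "i < m" using that(1) permutes_not_in by (metis lessThan_iff)
    ultimately show ?thesis by (intro prod_zero bexI[of _ i]) auto
  qed
  then have "ndet m (\<lambda>i j. if i = j then c else 0) =
      (\<Sum>p \<in> {id}. of_int (sign p) * (\<Prod>i<m. if i = p i then c else 0))"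
    unfolding ndet_def by (intro sum.mono_neutral_right) (auto simp: permutes_id finite_permutations)
  then show ?thesis by simp
qed

lemma abs_ndet_le:
  assumes "\<And>i j. i < m \<Longrightarrow> j < m \<Longrightarrow> \<bar>M i j\<bar> \<le> 1"
  shows "\<bar>ndet m M\<bar> \<le> fact m"
proof -
  have "\<bar>of_int (sign p) * (\<Prod>i<m. M i (p i))\<bar> \<le> 1" if p: "p permutes {..<m}" for p
  proof -
    have "\<bar>\<Prod>i<m. M i (p i)\<bar> \<le> 1"
      unfolding abs_prod using assms permutes_in_image[OF p] by (intro prod_le_1) auto
    then show ?thesis by (simp add: abs_mult sign_def)
  qed
  then have "\<bar>ndet m M\<bar> \<le> (\<Sum>p | p permutes {..<m}. 1)"
    unfolding ndet_def by (intro order.trans[OF sum_abs] sum_mono) auto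
  then show ?thesis by (simp add: card_permutations[of "{..<m}" m])
qed

context
  fixes k :: nat and u p :: "nat \<Rightarrow> real^'n"
  assumes k: "k \<le> CARD('n)"
    and u: "\<And>i j. i < k \<Longrightarrow> j < k \<Longrightarrow> u i \<bullet> u j = (if i = j then 1 else 0)"
    and pu: "\<And>i j. i < CARD('n) - k \<Longrightarrow> j < k \<Longrightarrow> p i \<bullet> u j = 0"
begin

text \<open>The frame completes \<open>p\<close> to \<open>n\<close> vectors, which makes the Gram
  determinant of \<open>p\<close> the square of a full determinant, up to scale. The scale
  \<open>c\<close> becomes the thickness in the volume bound and is 1 elsewhere.\<close>

lemma orient_det_scaled_orthonormal:
  "(orient_det (\<lambda>l. if l < k then c *\<^sub>R u l else p (l - k)))\<^sup>2 =
   (c ^ k)\<^sup>2 * ndet (CARD('n) - k) (\<lambda>i j. p i \<bullet> p j)"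
proof -
  have "ndet k (\<lambda>i j. (c *\<^sub>R u i) \<bullet> (c *\<^sub>R u j)) = ndet k (\<lambda>i j. if i = j then c\<^sup>2 else 0)"
    by (rule ndet_cong) (simp add: u power2_eq_square)
  then show ?thesis
    using orient_det_mult_orthogonal[OF k, of p "\<lambda>l. c *\<^sub>R u l" "\<lambda>l. c *\<^sub>R u l"] pu
    by (simp add: ndet_diagonal power2_eq_square power_mult_distrib)
qed

lemma gram_nonneg: "0 \<le> ndet (CARD('n) - k) (\<lambda>i j. p i \<bullet> p j)"
  using zero_le_power2[of "orient_det (\<lambda>l. if l < k then 1 *\<^sub>R u l else p (l - k))"]
  unfolding orient_det_scaled_orthonormal by simp

lemma abs_orient_det_scaled_orthonormal:
  assumes "0 \<le> c"
  shows "\<bar>orient_det (\<lambda>l. if l < k then c *\<^sub>R u l else p (l - k))\<bar> =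
    c ^ k * sqrt (ndet (CARD('n) - k) (\<lambda>i j. p i \<bullet> p j))"
  using arg_cong[OF orient_det_scaled_orthonormal[of c], of sqrt] assms
  by (simp add: real_sqrt_mult)

text \<open>Multiplying by the determinant with the frame \<open>u\<close>, which has absolute value
  \<open>sqrt G\<close> for the Gram determinant \<open>G\<close> of \<open>p\<close>, gives at most
  \<open>fact k * G\<close>; dividing again leaves a bound proportional to the volume of the
  piece.\<close>

lemma abs_orient_det_axis_le:
  fixes i :: "nat \<Rightarrow> 'n"
  assumes pos: "0 < ndet (CARD('n) - k) (\<lambda>i j. p i \<bullet> p j)"
  shows "\<bar>orient_det (\<lambda>l. if l < k then axis (i l) 1 else p (l - k))\<bar> \<le>
    fact k * sqrt (ndet (CARD('n) - k) (\<lambda>i j. p i \<bullet> p j))"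
proof -
  let ?G = "ndet (CARD('n) - k) (\<lambda>i j. p i \<bullet> p j)"
  let ?D = "orient_det (\<lambda>l. if l < k then axis (i l) 1 else p (l - k))"
  have "\<bar>axis (i l) 1 \<bullet> u j\<bar> \<le> 1" if "l < k" "j < k" for l j
    using Cauchy_Schwarz_ineq2[of "axis (i l) 1" "u j"] u[OF that(2) that(2)]
    by (simp add: norm_eq_sqrt_inner[of "u j"])
  then have le: "\<bar>ndet k (\<lambda>l j. axis (i l) 1 \<bullet> u j)\<bar> \<le> fact k"
    by (rule abs_ndet_le)
  have "?D * orient_det (\<lambda>l. if l < k then u l else p (l - k)) = ndet k (\<lambda>l j. axis (i l) 1 \<bullet> u j) * ?G"
    by (rule orient_det_mult_orthogonal[OF k pu])
  then have "\<bar>?D * orient_det (\<lambda>l. if l < k then u l else p (l - k))\<bar> =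
      \<bar>ndet k (\<lambda>l j. axis (i l) 1 \<bullet> u j) * ?G\<bar>"
    by (rule arg_cong)
  moreover have "\<bar>orient_det (\<lambda>l. if l < k then u l else p (l - k))\<bar> = sqrt ?G"
    using abs_orient_det_scaled_orthonormal[of 1, unfolded scaleR_one] by simp
  ultimately have "\<bar>?D\<bar> * sqrt ?G = \<bar>ndet k (\<lambda>l j. axis (i l) 1 \<bullet> u j)\<bar> * ?G"
    using pos by (simp only: abs_mult abs_of_pos)
  also have "\<dots> \<le> fact k * ?G"
    using le pos by (simp add: mult_right_mono)
  also have "\<dots> = (fact k * sqrt ?G) * sqrt ?G"
    using pos by simp
  finally show ?thesis
    using pos by (rule mult_right_le_imp_le[OF _ real_sqrt_gt_zero])
qed

lemma hodge_diff_le: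
  assumes pos: "0 < ndet (CARD('n) - k) (\<lambda>i j. p i \<bullet> p j)"
    and L: "\<And>i. i \<in> PiE {..<k} (\<lambda>_. UNIV::'n set) \<Longrightarrow>
      \<bar>a (\<lambda>j. axis (i j) 1) - b (\<lambda>j. axis (i j) 1)\<bar> \<le> L i"
  shows "\<bar>hodge k a p - hodge k b p\<bar> \<le>
    (\<Sum>i \<in> PiE {..<k} (\<lambda>_. UNIV::'n set). L i) * sqrt (ndet (CARD('n) - k) (\<lambda>i j. p i \<bullet> p j))"
proof -
  let ?I = "PiE {..<k} (\<lambda>_. UNIV::'n set)" and ?G = "ndet (CARD('n) - k) (\<lambda>i j. p i \<bullet> p j)"
  let ?D = "\<lambda>i :: nat \<Rightarrow> 'n. orient_det (\<lambda>l. if l < k then axis (i l) 1 else p (l - k))"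
  have "hodge k a p - hodge k b p =
      (\<Sum>i\<in>?I. (a (\<lambda>j. axis (i j) 1) - b (\<lambda>j. axis (i j) 1)) * ?D i) / fact k"
    by (simp add: hodge_def left_diff_distrib sum_subtractf diff_divide_distrib)
  also have "\<bar>\<dots>\<bar> \<le> (\<Sum>i\<in>?I. L i * (fact k * sqrt ?G)) / fact k"
  proof -
    have "\<bar>\<Sum>i\<in>?I. (a (\<lambda>j. axis (i j) 1) - b (\<lambda>j. axis (i j) 1)) * ?D i\<bar> \<le>
        (\<Sum>i\<in>?I. L i * (fact k * sqrt ?G))"
    proof (intro order.trans[OF sum_abs] sum_mono)
      fix i assume i: "i \<in> ?I"
      show "\<bar>(a (\<lambda>j. axis (i j) 1) - b (\<lambda>j. axis (i j) 1)) * ?D i\<bar> \<le> L i * (fact k * sqrt ?G)"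
        unfolding abs_mult using L[OF i] abs_orient_det_axis_le[OF pos, of i]
        by (intro mult_mono) auto
    qed
    then show ?thesis by (simp add: divide_right_mono)
  qed
  also have "\<dots> = (\<Sum>i\<in>?I. L i) * sqrt ?G"
    by (simp add: sum_distrib_right[symmetric] mult.assoc[symmetric])
  finally show ?thesis .
qed

end

text \<open>For a constant form both terms agree; hence the error of one piece of the dual cell is the
  difference of the averages of the same Lipschitz function over the simplex and over the piece.\<close>
lemma dual_piece_error:
  fixes vs q u :: "nat \<Rightarrow> real^'n" and \<omega> :: "real^'n \<Rightarrow> (nat \<Rightarrow> real^'n) \<Rightarrow> real"
  defines "e \<equiv> \<lambda>j. vs (Suc j) - vs 0" and "p \<equiv> \<lambda>j. q (Suc j) - q 0"
  assumes k: "k \<le> CARD('n)"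
    and u: "\<And>i j. i < k \<Longrightarrow> j < k \<Longrightarrow> u i \<bullet> u j = (if i = j then 1 else 0)"
    and pu: "\<And>i j. i < CARD('n) - k \<Longrightarrow> j < k \<Longrightarrow> p i \<bullet> u j = 0"
    and pe: "\<And>i j. i < CARD('n) - k \<Longrightarrow> j < k \<Longrightarrow> p i \<bullet> e j = 0"
    and S: "compact S" "convex S" and diam: "\<And>x y. x \<in> S \<Longrightarrow> y \<in> S \<Longrightarrow> dist x y \<le> h"
    and vs: "\<And>j. j \<le> k \<Longrightarrow> vs j \<in> S" and q: "\<And>j. j \<le> CARD('n) - k \<Longrightarrow> q j \<in> S"
    and alt: "\<And>x. x \<in> S \<Longrightarrow> alt_form k (\<omega> x)"
    and L: "\<And>i x y. i \<in> PiE {..<k} (\<lambda>_. UNIV::'n set) \<Longrightarrow> x \<in> S \<Longrightarrow> y \<in> S \<Longrightarrow>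
      \<bar>\<omega> x (\<lambda>j. axis (i j) 1) - \<omega> y (\<lambda>j. axis (i j) 1)\<bar> \<le> L i * dist x y"
    and L_nonneg: "\<And>i. i \<in> PiE {..<k} (\<lambda>_. UNIV::'n set) \<Longrightarrow> 0 \<le> L i"
  shows "\<bar>kvol (CARD('n) - k) q / kvol k vs * integ k \<omega> vs -
      sgn (orient_det (\<lambda>l. if l < k then e l else p (l - k))) *
        integ (CARD('n) - k) (\<lambda>x. hodge k (\<omega> x)) q\<bar> \<le>
    2 * (\<Sum>i \<in> PiE {..<k} (\<lambda>_. UNIV::'n set). L i) * h * kvol (CARD('n) - k) q"
proof -
  let ?n = "CARD('n)"
  define D where "D = orient_det (\<lambda>l. if l < k then e l else p (l - k))"
  define G where "G = ndet (?n - k) (\<lambda>i j. p i \<bullet> p j)"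
  define E where "E = ndet k (\<lambda>i j. e i \<bullet> e j)"
  define \<Lambda> where "\<Lambda> = (\<Sum>i \<in> PiE {..<k} (\<lambda>_. UNIV::'n set). L i)"
  have \<Lambda>: "0 \<le> \<Lambda>" unfolding \<Lambda>_def by (rule sum_nonneg[OF L_nonneg])
  have h: "0 \<le> h" using diam[of "vs 0" "vs 0"] vs[of 0] by simp
  have kvol_q: "kvol (?n - k) q = sqrt G / fact (?n - k)"
    by (simp add: kvol_def G_def p_def)
  have kvol_vs: "kvol k vs = sqrt E / fact k"
    by (simp add: kvol_def E_def e_def)
  have DD: "D\<^sup>2 = E * G"
    using orient_det_mult_orthogonal[where b = e, OF k pe] by (simp add: power2_eq_square D_def E_def G_def)
  have G: "0 \<le> G" unfolding G_def by (rule gram_nonneg[OF k u pu])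
  show ?thesis
  proof (cases "D = 0")
    case True
    \<comment> \<open>Degenerate case: \<open>sgn 0 = 0\<close>, and the volume quotient is 0 too,
      either by its numerator or because division by zero gives 0.\<close>
    then have "E = 0 \<or> G = 0" using DD by simp
    then have zero: "kvol (?n - k) q / kvol k vs = 0" by (auto simp: kvol_q kvol_vs)
    show ?thesis
      unfolding D_def[symmetric] \<Lambda>_def[symmetric] zero True using \<Lambda> h G by (simp add: kvol_q)
  next
    case False
    then have Gpos: "0 < G" using DD G by (cases "G = 0") auto
    then have Epos: "0 < E" using DD False by (metis zero_less_mult_pos2 zero_less_power2)
    have absD: "\<bar>D\<bar> = sqrt E * sqrt G"
      using arg_cong[OF DD, of sqrt] by (simp add: real_sqrt_mult)
    define F where "F x = hodge k (\<omega> x) p" for x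
    have F: "\<bar>F x - F y\<bar> \<le> \<Lambda> * sqrt G * dist x y" if "x \<in> S" "y \<in> S" for x y
    proof -
      have "\<bar>F x - F y\<bar> \<le> (\<Sum>i \<in> PiE {..<k} (\<lambda>_. UNIV::'n set). L i * dist x y) * sqrt G"
        unfolding F_def G_def
        by (rule hodge_diff_le[where u = u, OF k u pu Gpos[unfolded G_def]]) (use L that in auto)
      then show ?thesis by (simp add: \<Lambda>_def sum_distrib_right[symmetric] mult_ac)
    qed
    \<comment> \<open>On the edges of \<open>\<tau>\<close> the form is a fixed multiple of
      \<open>F\<close>, so both integrals of the claim become integrals of the one function
      \<open>F\<close>.\<close>
    have Fe: "\<omega> x e = sqrt E / sqrt G * sgn D * F x" if "x \<in> S" for x
    proof -
      have "F x * D = G * \<omega> x e"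
        unfolding F_def D_def G_def by (rule hodge_mult_orient_det[OF alt[OF that] k pe])
      then have "\<omega> x e = \<bar>D\<bar> * sgn D * F x / G"
        using Gpos by (simp add: abs_mult_sgn field_simps)
      also have "\<dots> = sqrt E / sqrt G * sgn D * F x"
        using Gpos real_sqrt_mult_self[of G] unfolding absD by (simp add: field_simps)
      finally show ?thesis .
    qed
    have cont: "continuous_on S F"
    proof (rule continuous_on_subset[OF lipschitz_on_continuous_on])
      show "(\<Lambda> * sqrt G)-lipschitz_on S F"
        using F \<Lambda> G by (intro lipschitz_onI) (auto simp: dist_real_def)
    qed simp
    have near: "\<bar>F x - F (vs 0)\<bar> \<le> \<Lambda> * sqrt G * h" if "x \<in> S" for x
    proof -
      have "\<bar>F x - F (vs 0)\<bar> \<le> \<Lambda> * sqrt G * dist x (vs 0)"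
        using F[OF that vs[of 0]] by simp
      also have "\<dots> \<le> \<Lambda> * sqrt G * h"
        using diam[OF that vs[of 0]] \<Lambda> G by (intro mult_left_mono) auto
      finally show ?thesis .
    qed
    \<comment> \<open>The averages of \<open>F\<close> over \<open>\<tau>\<close> and over the dual
      piece. Each is compared with the value at the vertex \<open>vs 0\<close>, whence the factor
      2.\<close>
    define A1 where "A1 = fact k * integral\<^sup>L (Pi\<^sub>M {..<k} (\<lambda>_. lborel))
            (\<lambda>t. indicator (std_simplex k) t * F (simplex_map k vs t))"
    define A2 where "A2 = fact (?n - k) * integral\<^sup>L (Pi\<^sub>M {..<?n - k} (\<lambda>_. lborel))
            (\<lambda>t. indicator (std_simplex (?n - k)) t * F (simplex_map (?n - k) q t))"
    have vsS: "simplex_map k vs t \<in> S" if "t \<in> std_simplex k" for t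
      using simplex_map_mem_convex[OF S(2) vs that] .
    have qS: "simplex_map (?n - k) q t \<in> S" if "t \<in> std_simplex (?n - k)" for t
      using simplex_map_mem_convex[OF S(2) q that] .
    have A1: "\<bar>A1 - F (vs 0)\<bar> \<le> \<Lambda> * sqrt G * h"
      unfolding A1_def by (rule simplex_average_bound[OF S(1) cont vsS near])
    have A2: "\<bar>A2 - F (vs 0)\<bar> \<le> \<Lambda> * sqrt G * h"
      unfolding A2_def by (rule simplex_average_bound[OF S(1) cont qS near])
    have "integ k \<omega> vs = (\<integral>t. (sqrt E / sqrt G * sgn D) *
        (indicator (std_simplex k) t * F (simplex_map k vs t)) \<partial>Pi\<^sub>M {..<k} (\<lambda>_. lborel))"
      unfolding integ_def e_def[symmetric]
      by (rule Bochner_Integration.integral_cong) (auto simp: Fe vsS indicator_def)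
    also have "\<dots> = sqrt E / sqrt G * sgn D * (A1 / fact k)"
      by (simp add: A1_def)
    finally have "kvol (?n - k) q / kvol k vs * integ k \<omega> vs = sgn D * A1 / fact (?n - k)"
      using Gpos Epos by (simp add: kvol_q kvol_vs field_simps)
    moreover have "integ (?n - k) (\<lambda>x. hodge k (\<omega> x)) q = A2 / fact (?n - k)"
      unfolding integ_def A2_def F_def p_def by simp
    ultimately have "\<bar>kvol (?n - k) q / kvol k vs * integ k \<omega> vs -
        sgn D * integ (?n - k) (\<lambda>x. hodge k (\<omega> x)) q\<bar> = \<bar>sgn D * (A1 - A2) / fact (?n - k)\<bar>"
      by (simp add: right_diff_distrib diff_divide_distrib)
    also have "\<dots> = \<bar>A1 - A2\<bar> / fact (?n - k)"
      using False by (simp add: abs_mult abs_sgn_eq)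
    also have "\<dots> \<le> (2 * (\<Lambda> * sqrt G * h)) / fact (?n - k)"
      using A1 A2 by (intro divide_right_mono) auto
    finally show ?thesis
      by (simp add: D_def \<Lambda>_def kvol_q mult_ac)
  qed
qed

text \<open>Orthogonality to the frame is phrased through differences of vertices, the form in which
  circumcenters supply it.\<close>

lemma orthonormal_frame_of_simplex:
  fixes vs :: "nat \<Rightarrow> real^'n"
  assumes vs: "bij_betw vs {..k} \<tau>" and ind: "\<not> affine_dependent \<tau>"
  obtains u :: "nat \<Rightarrow> real^'n" where
    "\<And>i j. i < k \<Longrightarrow> j < k \<Longrightarrow> u i \<bullet> u j = (if i = j then 1 else 0)"
    "\<And>x j. (\<And>v w. v \<in> \<tau> \<Longrightarrow> w \<in> \<tau> \<Longrightarrow> x \<bullet> (v - w) = 0) \<Longrightarrow> j < k \<Longrightarrow> x \<bullet> u j = 0"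
proof -
  have v0: "vs 0 \<in> \<tau>" using vs by (auto simp: bij_betw_def)
  define E where "E = (\<lambda>x. - vs 0 + x) ` (\<tau> - {vs 0})"
  have "independent E"
    using affine_dependent_iff_dependent2[OF v0] ind unfolding E_def by blast
  moreover have "card E = k"
  proof -
    have "card E = card (\<tau> - {vs 0})" unfolding E_def by (rule card_image) simp
    also have "\<dots> = k" using bij_betw_same_card[OF vs] v0 by simp
    finally show ?thesis .
  qed
  ultimately have dim: "dim (span E) = k" by (simp add: dim_eq_card_independent)
  obtain B where B: "B \<subseteq> span E" "pairwise orthogonal B" "\<And>x. x \<in> B \<Longrightarrow> norm x = 1" "card B = k" "independent B"
    using orthonormal_basis_subspace[OF subspace_span[of E]] dim by metis
  have "finite B" using B(5) independent_imp_finite by blast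
  then obtain u where u: "bij_betw u {..<k} B"
    using ex_bij_betw_nat_finite[of B] B(4) by (auto simp: atLeast0LessThan)
  show ?thesis
  proof
    fix i j assume ij: "i < k" "j < k"
    then have "u i \<in> B" "u j \<in> B" using u by (auto simp: bij_betw_def)
    moreover have "u i = u j \<longleftrightarrow> i = j" using u ij by (auto simp: bij_betw_def inj_on_def)
    ultimately show "u i \<bullet> u j = (if i = j then 1 else 0)"
      using B(2) B(3)[of "u j"] by (auto simp: pairwise_def orthogonal_def norm_eq_1)
  next
    fix x j assume x: "\<And>v w. v \<in> \<tau> \<Longrightarrow> w \<in> \<tau> \<Longrightarrow> x \<bullet> (v - w) = 0" and "j < k"
    have "orthogonal x e" if "e \<in> E" for e
      using that x v0 by (auto simp: E_def orthogonal_def)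
    moreover have "u j \<in> span E" using u B(1) \<open>j < k\<close> by (auto simp: bij_betw_def)
    ultimately show "x \<bullet> u j = 0"
      using orthogonal_to_span by (metis orthogonal_def)
  qed
qed

section \<open>The dual cell\<close>

lemma dual_chainsD:
  assumes "ch \<in> dual_chains K k (\<tau> :: (real^'n) set)"
  shows "ch 0 = \<tau>" and "\<And>j. j \<le> CARD('n) - k \<Longrightarrow> ch j \<in> K"
    and "\<And>j. j < CARD('n) - k \<Longrightarrow> ch j \<subset> ch (Suc j)"
    and "\<And>j. j \<le> CARD('n) - k \<Longrightarrow> card (ch j) = k + j + 1"
  using assms unfolding dual_chains_def by auto

lemma finite_dual_chains:
  assumes "finite K"
  shows "finite (dual_chains K k (\<tau> :: (real^'n) set))"
proof (rule finite_subset)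
  show "dual_chains K k \<tau> \<subseteq> PiE {..CARD('n) - k} (\<lambda>_. K)"
    unfolding dual_chains_def by blast
qed (use assms in \<open>simp add: finite_PiE\<close>)

lemma sum_lessThan_add:
  fixes f :: "nat \<Rightarrow> 'a::comm_monoid_add"
  assumes "k \<le> n"
  shows "(\<Sum>l<n. f l) = (\<Sum>l<k. f l) + (\<Sum>j<n - k. f (k + j))"
proof -
  have "(\<Sum>l<k + m. f l) = (\<Sum>l<k. f l) + (\<Sum>j<m. f (k + j))" for m
    by (induction m) (simp_all add: add.assoc)
  from this[of "n - k"] show ?thesis using assms by simp
qed

text \<open>The pieces of the dual cell, thickened in the directions of \<open>\<tau>\<close> by orthogonal segments of
  length \<open>h\<close>, become disjoint \<open>n\<close>-simplices in a ball of radius \<open>h\<close>; this avoids counting the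
  simplices around \<open>\<tau>\<close>, whose number is not bounded.\<close>
lemma dual_vol_le:
  fixes K :: "(real^'n) set set"
  assumes K: "simplicial_complex K" and wc: "well_centered K" and h: "max_edge K = h" "0 < h"
    and k: "k \<le> CARD('n)" and \<tau>: "\<tau> \<in> K" "bij_betw vs {..k} \<tau>"
  shows "dual_vol K k \<tau> \<le> unit_ball_vol (real CARD('n)) /
    measure lebesgue (open_std_simplex :: (real^('n coord_index)) set) * h ^ (CARD('n) - k)"
proof -
  let ?n = "CARD('n)" and ?C = "dual_chains K k \<tau>"
  let ?V = "unit_ball_vol (real CARD('n)) / measure lebesgue (open_std_simplex :: (real^('n coord_index)) set)"
  have ind: "\<not> affine_dependent s" if "s \<in> K" for s
    using K that unfolding simplicial_complex_def by meson
  have finK: "finite K" using K unfolding simplicial_complex_def by meson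
  obtain u :: "nat \<Rightarrow> real^'n" where
    u: "\<And>i j. i < k \<Longrightarrow> j < k \<Longrightarrow> u i \<bullet> u j = (if i = j then 1 else 0)" and
    xu: "\<And>x j. (\<And>v w. v \<in> \<tau> \<Longrightarrow> w \<in> \<tau> \<Longrightarrow> x \<bullet> (v - w) = 0) \<Longrightarrow> j < k \<Longrightarrow> x \<bullet> u j = 0"
    using orthonormal_frame_of_simplex[OF \<tau>(2) ind[OF \<tau>(1)]] by blast
  define p where "p ch j = circumcenter (ch (Suc j)) - circumcenter (ch 0)"
    for ch :: "nat \<Rightarrow> (real^'n) set" and j
  \<comment> \<open>The thickness \<open>h\<close> matches the bound on the dual edges and
    contributes exactly \<open>h ^ k\<close> to each determinant, which is cancelled at the
    end.\<close>
  define w where "w ch l = (if l < k then h *\<^sub>R u l else p ch (l - k))" for ch l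
  have pu: "p ch i \<bullet> u j = 0" if "ch \<in> ?C" "i < ?n - k" "j < k" for ch i j
  proof (rule xu[OF _ that(3)])
    note ch = dual_chainsD[OF that(1)]
    fix v w assume "v \<in> \<tau>" "w \<in> \<tau>"
    moreover have "ch 0 \<subseteq> ch (Suc i)"
      using strict_chain_mono[of "?n - k" ch 0 "Suc i", OF ch(3)] that(2) by simp
    ultimately show "p ch i \<bullet> (v - w) = 0"
      unfolding p_def using ind[OF ch(2)[of "Suc i"]] that(2) ch(1)
      by (intro circumcenter_diff_orthogonal) auto
  qed
  have vol: "\<bar>orient_det (w ch)\<bar> = h ^ k * (fact (?n - k) * kvol (?n - k) (\<lambda>j. circumcenter (ch j)))"
    if "ch \<in> ?C" for ch
    using abs_orient_det_scaled_orthonormal[where c = h, OF k u pu[OF that]] h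
    by (simp add: w_def[abs_def] kvol_def p_def)
  have "(\<Sum>ch\<in>?C. \<bar>orient_det (w ch)\<bar>) \<le> ?V * h ^ ?n"
  proof (rule sum_orient_det_le)
    show "finite ?C" by (rule finite_dual_chains[OF finK])
    show "0 \<le> h" using h by simp
    fix ch l assume ch: "ch \<in> ?C" and l: "l < ?n"
    show "norm (w ch l) \<le> h"
    proof (cases "l < k")
      case True
      then show ?thesis using u[of l l] h by (simp add: w_def norm_eq_sqrt_inner)
    next
      case False
      then have "Suc (l - k) \<le> ?n - k" using l by simp
      then have "dist (circumcenter (ch (Suc (l - k)))) (circumcenter (ch 0)) \<le> h"
        using circumcenter_in_chain_top[of K "?n - k" ch, OF wc dual_chainsD(2,3)[OF ch]] h
          dist_le_max_edge[OF K _ dual_chainsD(2)[OF ch order_refl]] by simp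
      then show ?thesis using False by (simp add: w_def p_def dist_norm)
    qed
  next
    fix ch ch' x x'
    assume ch: "ch \<in> ?C" "ch' \<in> ?C"
      and x: "\<And>l. l < ?n \<Longrightarrow> 0 < x l" "(\<Sum>l<?n. x l) < 1"
      and x': "\<And>l. l < ?n \<Longrightarrow> 0 < x' l" "(\<Sum>l<?n. x' l) < 1"
      and eq: "(\<Sum>l<?n. x l *\<^sub>R w ch l) = (\<Sum>l<?n. x' l *\<^sub>R w ch' l)"
    define a where "a y = (\<Sum>l<k. y l *\<^sub>R h *\<^sub>R u l)" for y :: "nat \<Rightarrow> real"
    define b where "b c y = (\<Sum>j<?n - k. y (k + j) *\<^sub>R p c j)"
      for c :: "nat \<Rightarrow> (real^'n) set" and y :: "nat \<Rightarrow> real"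
    have split: "(\<Sum>l<?n. y l *\<^sub>R w c l) = a y + b c y" for y c
      unfolding sum_lessThan_add[OF k] by (simp add: a_def b_def w_def)
    have orth: "b c y \<bullet> a z = 0" if "c \<in> ?C" for c y z
      unfolding a_def b_def by (simp add: inner_sum_left inner_sum_right pu[OF that])
    \<comment> \<open>The difference of the dual parts equals a vector along \<open>\<tau>\<close>
      to which it is also orthogonal, so it vanishes: equal thickened points lie over the same point
      of the dual cell.\<close>
    have "b ch x - b ch' x' = a x' - a x"
      using eq by (simp add: split algebra_simps)
    then have "(b ch x - b ch' x') \<bullet> (b ch x - b ch' x') = (b ch x - b ch' x') \<bullet> (a x' - a x)"
      by simp
    also have "\<dots> = 0" using orth ch by (simp add: inner_diff_left inner_diff_right)
    finally have "b ch x = b ch' x'" by simp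
    then have eq': "circumcenter (ch 0) + b ch x = circumcenter (ch' 0) + b ch' x'"
      using dual_chainsD(1)[OF ch(1)] dual_chainsD(1)[OF ch(2)] by simp
    \<comment> \<open>Barycentric weights in the dual piece. The weight of the circumcenter of
      \<open>\<tau>\<close> is positive because the coordinates along \<open>\<tau>\<close> are
      nonnegative and all coordinates sum to less than 1.\<close>
    define \<beta> where "\<beta> y j = (case j of 0 \<Rightarrow> 1 - (\<Sum>j<?n - k. y (k + j)) | Suc i \<Rightarrow> y (k + i))"
      for y :: "nat \<Rightarrow> real" and j
    have \<beta>: "0 < \<beta> y j" "(\<Sum>j\<le>?n - k. \<beta> y j) = 1"
      if y: "\<And>l. l < ?n \<Longrightarrow> 0 < y l" "(\<Sum>l<?n. y l) < 1" and j: "j \<le> ?n - k" for y j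
    proof -
      have "0 \<le> (\<Sum>l<k. y l)" using y(1) k by (intro sum_nonneg) (auto intro: less_imp_le)
      then have "(\<Sum>j<?n - k. y (k + j)) < 1" using y(2) sum_lessThan_add[OF k, of y] by simp
      then show "0 < \<beta> y j" using y(1) j by (auto simp: \<beta>_def split: nat.split)
      show "(\<Sum>j\<le>?n - k. \<beta> y j) = 1"
        by (simp add: \<beta>_def lessThan_Suc_atMost[symmetric] sum.lessThan_Suc_shift del: sum.lessThan_Suc)
    qed
    have point: "circumcenter (c 0) + b c y = (\<Sum>j\<le>?n - k. \<beta> y j *\<^sub>R circumcenter (c j))" for c y
      unfolding b_def p_def \<beta>_def by (rule sum_shift_base)
    have "ch j = ch' j" if "j \<le> ?n - k" for j
    proof (rule chain_unique[OF K wc, where m = "?n - k" and b = "\<beta> x" and b' = "\<beta> x'"])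
      show "(\<Sum>j\<le>?n - k. \<beta> x j *\<^sub>R circumcenter (ch j)) = (\<Sum>j\<le>?n - k. \<beta> x' j *\<^sub>R circumcenter (ch' j))"
        using eq' unfolding point .
    qed (use dual_chainsD(2,3)[OF ch(1)] dual_chainsD(2,3)[OF ch(2)] \<beta>[OF x] \<beta>[OF x'] that in blast)+
    then show "ch = ch'"
      using ch unfolding dual_chains_def by (intro PiE_ext[of ch "{..?n - k}" "\<lambda>_. K" ch']) auto
  qed
  then have le: "h ^ k * fact (?n - k) * dual_vol K k \<tau> \<le> ?V * h ^ ?n"
    by (simp add: vol dual_vol_def sum_distrib_left mult.assoc)
  \<comment> \<open>\<open>sqrt\<close> is negative at negative numbers, so the sign of
    \<open>kvol\<close> is read off \<open>vol\<close>. Nonnegativity allows dropping the factor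
    \<open>fact (?n - k)\<close>.\<close>
  have nonneg: "0 \<le> dual_vol K k \<tau>"
    unfolding dual_vol_def
  proof (rule sum_nonneg)
    fix ch assume "ch \<in> ?C"
    then have "0 \<le> h ^ k * (fact (?n - k) * kvol (?n - k) (\<lambda>j. circumcenter (ch j)))"
      using vol abs_ge_zero by metis
    then show "0 \<le> kvol (?n - k) (\<lambda>j. circumcenter (ch j))"
      using zero_less_power[OF h(2), of k] fact_gt_zero[of "?n - k", where 'a = real]
      by (auto simp: zero_le_mult_iff dest: leD)
  qed
  have "h ^ k * dual_vol K k \<tau> \<le> h ^ k * fact (?n - k) * dual_vol K k \<tau>"
    using h nonneg fact_ge_1[of "?n - k", where 'a = real] by (simp add: mult_right_mono mult_le_cancel_left1)
  also note le
  also have "h ^ ?n = h ^ k * h ^ (?n - k)"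
    using k by (simp add: power_add[symmetric])
  finally have "h ^ k * dual_vol K k \<tau> \<le> h ^ k * (?V * h ^ (?n - k))" by (simp only: mult_ac)
  then show ?thesis by (rule mult_left_le_imp_le) (use h in simp)
qed

section \<open>Summation of the errors over the pieces of the dual cell\<close>

theorem theorem3p2:
  fixes P :: "(real^'n) set"
    and H :: "real set"
    and K :: "real \<Rightarrow> (real^'n) set set"
    and \<omega> :: "real^'n \<Rightarrow> (nat \<Rightarrow> real^'n) \<Rightarrow> real"
    and k :: nat
  assumes "polytope P" and "aff_dim P = int CARD('n)"
    and "H \<subseteq> {0<..}"
    and "\<forall>h\<in>H. triangulates (K h) P \<and> well_centered (K h) \<and> max_edge (K h) = h"
    and "C1_form P k \<omega>"
  shows "\<exists>C. \<forall>h\<in>H. \<forall>\<sigma>\<in>K h. \<forall>\<tau> (vs :: nat \<Rightarrow> real^'n).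
           card \<sigma> = CARD('n) + 1 \<longrightarrow> \<tau> \<subseteq> \<sigma> \<longrightarrow> card \<tau> = k + 1 \<longrightarrow>
           bij_betw vs {..k} \<tau> \<longrightarrow>
           \<bar>discrete_hodge_deRham (K h) k \<omega> vs
              - dual_integ (K h) k (\<lambda>x. hodge k (\<omega> x)) vs\<bar>
             \<le> C * h ^ (CARD('n) + 1) / inradius \<tau> ^ k"
proof -
  let ?n = "CARD('n)" and ?I = "PiE {..<k} (\<lambda>_. UNIV::'n set)"
  have P: "compact P" "convex P"
    using assms(1) polytope_imp_compact polytope_imp_convex by auto
  have alt: "alt_form k (\<omega> x)" if "x \<in> P" for x
    using assms(5) that unfolding C1_form_def by blast
  \<comment> \<open>The Lipschitz constants are taken on all of \<open>P\<close>, hence are the same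
    for every \<open>h\<close> and every simplex.\<close>
  have "\<exists>L. 0 \<le> L \<and> (\<forall>x\<in>P. \<forall>y\<in>P. \<bar>\<omega> x (\<lambda>j. axis (i j) 1) - \<omega> y (\<lambda>j. axis (i j) 1)\<bar> \<le> L * dist x y)"
    for i :: "nat \<Rightarrow> 'n"
    using C1_form_lipschitz[OF assms(5) P(2,1), of "\<lambda>j. axis (i j) 1"] by metis
  then obtain L where L0: "\<And>i. 0 \<le> L i" and
    L: "\<And>i x y. x \<in> P \<Longrightarrow> y \<in> P \<Longrightarrow>
      \<bar>\<omega> x (\<lambda>j. axis (i j) 1) - \<omega> y (\<lambda>j. axis (i j) 1)\<bar> \<le> L i * dist x y"
    by metis
  define V where "V = unit_ball_vol (real ?n) / measure lebesgue (open_std_simplex :: (real^('n coord_index)) set)"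
  have V: "0 \<le> V" unfolding V_def by simp
  define \<Lambda> where "\<Lambda> = 2 * (\<Sum>i\<in>?I. L i)"
  have \<Lambda>: "0 \<le> \<Lambda>" unfolding \<Lambda>_def using L0 by (simp add: sum_nonneg)
  show ?thesis
  proof (intro exI[of _ "\<Lambda> * V"] ballI allI impI)
    fix h \<sigma> \<tau> and vs :: "nat \<Rightarrow> real^'n"
    assume h: "h \<in> H" and \<sigma>: "\<sigma> \<in> K h" "card \<sigma> = ?n + 1" and \<tau>: "\<tau> \<subseteq> \<sigma>" "card \<tau> = k + 1"
      and vs: "bij_betw vs {..k} \<tau>"
    have hpos: "0 < h" using h assms(3) by auto
    have wc: "well_centered (K h)" and edge: "max_edge (K h) = h"
      and tri: "triangulates (K h) P" using assms(4) h by auto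
    have sc: "simplicial_complex (K h)"
      and cover: "\<Union>{convex hull s | s. s \<in> K h \<and> card s = ?n + 1} = P"
      using tri unfolding triangulates_def by blast+
    have ind: "finite s" "\<not> affine_dependent s" if "s \<in> K h" for s
      using sc that unfolding simplicial_complex_def by meson+
    have "\<tau> \<noteq> {}" using \<tau>(2) by auto
    then have \<tau>K: "\<tau> \<in> K h"
      using sc \<sigma>(1) \<tau>(1) unfolding simplicial_complex_def by meson
    have k: "k \<le> ?n"
      using card_mono[OF ind(1)[OF \<sigma>(1)] \<tau>(1)] \<sigma>(2) \<tau>(2) by simp
    have vs_eq: "vs ` {..k} = \<tau>" using vs by (simp add: bij_betw_def)
    have diam: "dist x y \<le> h" if "s \<in> K h" "x \<in> convex hull s" "y \<in> convex hull s" for s x y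
      using dist_le_max_edge[OF sc _ that] edge hpos by simp
    obtain u :: "nat \<Rightarrow> real^'n" where
      u: "\<And>i j. i < k \<Longrightarrow> j < k \<Longrightarrow> u i \<bullet> u j = (if i = j then 1 else 0)" and
      xu: "\<And>x j. (\<And>v w. v \<in> \<tau> \<Longrightarrow> w \<in> \<tau> \<Longrightarrow> x \<bullet> (v - w) = 0) \<Longrightarrow> j < k \<Longrightarrow> x \<bullet> u j = 0"
      using orthonormal_frame_of_simplex[OF vs ind(2)[OF \<tau>K]] by blast
    let ?C = "dual_chains (K h) k \<tau>"
    let ?D = "\<lambda>ch. orient_det (\<lambda>l. if l < k then vs (Suc l) - vs 0
        else circumcenter (ch (Suc (l - k))) - circumcenter (ch 0))"
    let ?kvol = "\<lambda>ch. kvol (?n - k) (\<lambda>j. circumcenter (ch j))"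
    let ?err = "\<lambda>ch. ?kvol ch / kvol k vs * integ k \<omega> vs -
        sgn (?D ch) * integ (?n - k) (\<lambda>x. hodge k (\<omega> x)) (\<lambda>j. circumcenter (ch j))"
    have piece: "\<bar>?err ch\<bar> \<le> \<Lambda> * h * ?kvol ch" if "ch \<in> ?C" for ch
    proof -
      note ch = dual_chainsD[OF that]
      \<comment> \<open>The top simplex of the chain contains \<open>\<tau>\<close> and all
        circumcenters of the chain, has diameter at most \<open>h\<close>, and lies in
        \<open>P\<close> as one of its \<open>n\<close>-simplices.\<close>
      let ?S = "convex hull (ch (?n - k))"
      have top: "ch (?n - k) \<in> K h" using ch(2) by simp
      have orth: "(circumcenter (ch (Suc i)) - circumcenter (ch 0)) \<bullet> (v - w) = 0"
        if "i < ?n - k" "v \<in> \<tau>" "w \<in> \<tau>" for i v w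
      proof -
        have "ch 0 \<subseteq> ch (Suc i)"
          using strict_chain_mono[of "?n - k" ch 0 "Suc i", OF ch(3)] that(1) by simp
        then show ?thesis
          using ind(2)[OF ch(2)[of "Suc i"]] that ch(1)
          by (intro circumcenter_diff_orthogonal) auto
      qed
      have "card (ch (?n - k)) = ?n + 1" using ch(4)[of "?n - k"] k by simp
      then have SP: "?S \<subseteq> P" unfolding cover[symmetric] using top by blast
      have vs_in: "vs j \<in> \<tau>" if "j \<le> k" for j using that vs_eq by auto
      have "\<tau> \<subseteq> ch (?n - k)"
        using strict_chain_mono[of "?n - k" ch 0 "?n - k", OF ch(3)] ch(1) by simp
      then have vsS: "vs j \<in> ?S" if "j \<le> k" for j
        by (rule hull_inc[OF subsetD[OF _ vs_in[OF that]]])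
      have qS: "circumcenter (ch j) \<in> ?S" if "j \<le> ?n - k" for j
        using circumcenter_in_chain_top[of "K h" "?n - k" ch j, OF wc ch(2,3) that] .
      show ?thesis
        unfolding \<Lambda>_def
      proof (rule dual_piece_error[where u = u and S = ?S])
        show "compact ?S" using ind(1)[OF top] finite_imp_compact_convex_hull by blast
        show "dist x y \<le> h" if "x \<in> ?S" "y \<in> ?S" for x y using diam[OF top that] .
        show "alt_form k (\<omega> x)" if "x \<in> ?S" for x using alt SP that by blast
        show "\<bar>\<omega> x (\<lambda>j. axis (i j) 1) - \<omega> y (\<lambda>j. axis (i j) 1)\<bar> \<le> L i * dist x y"
          if "x \<in> ?S" "y \<in> ?S" for i x y using L SP that by blast
        show "(circumcenter (ch (Suc i)) - circumcenter (ch 0)) \<bullet> u j = 0"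
          if "i < ?n - k" "j < k" for i j using xu[OF orth] that by blast
        show "(circumcenter (ch (Suc i)) - circumcenter (ch 0)) \<bullet> (vs (Suc j) - vs 0) = 0"
          if "i < ?n - k" "j < k" for i j using orth vs_in that by simp
      qed (use k u vsS qS L0 in auto)
    qed
    have "discrete_hodge_deRham (K h) k \<omega> vs - dual_integ (K h) k (\<lambda>x. hodge k (\<omega> x)) vs = (\<Sum>ch\<in>?C. ?err ch)"
      unfolding discrete_hodge_deRham_def dual_vol_def dual_integ_def vs_eq
      by (simp add: sum_subtractf sum_divide_distrib sum_distrib_right)
    then have "\<bar>discrete_hodge_deRham (K h) k \<omega> vs - dual_integ (K h) k (\<lambda>x. hodge k (\<omega> x)) vs\<bar> \<le>
        (\<Sum>ch\<in>?C. \<Lambda> * h * ?kvol ch)"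
      using piece by (simp only:) (intro order.trans[OF sum_abs] sum_mono)
    also have "\<dots> = \<Lambda> * h * dual_vol (K h) k \<tau>"
      by (simp add: dual_vol_def sum_distrib_left)
    also have "\<dots> \<le> \<Lambda> * h * (V * h ^ (?n - k))"
      using \<Lambda> hpos dual_vol_le[OF sc wc edge hpos k \<tau>K vs]
      by (intro mult_left_mono) (auto simp: V_def)
    also have "\<dots> = \<Lambda> * V * h ^ (?n - k + 1)" by simp
    also have "\<dots> \<le> \<Lambda> * V * (h ^ (?n + 1) / inradius \<tau> ^ k)"
    proof (rule mult_left_mono)
      have eq: "h ^ (?n + 1) = h ^ k * h ^ (?n - k + 1)"
        using k by (simp only: power_add[symmetric]) simp
      show "h ^ (?n - k + 1) \<le> h ^ (?n + 1) / inradius \<tau> ^ k"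
      \<comment> \<open>For a vertex the supremum in \<open>inradius\<close> is over an unbounded
        set, but the exponent 0 turns the denominator into 1.\<close>
      proof (cases "k = 0")
        case False
        then have "0 < inradius \<tau>" "inradius \<tau> \<le> h"
          using inradius_bounds[OF ind(1)[OF \<tau>K], of h] \<tau>(2) diam[OF \<tau>K] by auto
        then have "inradius \<tau> ^ k \<le> h ^ k" "0 < inradius \<tau> ^ k"
          by (auto intro: power_mono)
        then show ?thesis
          unfolding eq using hpos by (simp add: pos_le_divide_eq mult.commute mult_right_mono)
      qed simp
    qed (use \<Lambda> V in simp)
    finally show "\<bar>discrete_hodge_deRham (K h) k \<omega> vs - dual_integ (K h) k (\<lambda>x. hodge k (\<omega> x)) vs\<bar>
        \<le> \<Lambda> * V * h ^ (?n + 1) / inradius \<tau> ^ k" by simp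
  qed
qed

end
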